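(* Let $d\ge 3$ be an odd integer. Suppose that $g:[0,\infty)\to\mathbb{R}$ is a continuous function with compact support contained in $[0,\pi]$. If $g$ is isotropic positive definite on $\mathbb{R}^d$, then $g$ is isotropic positive definite on $\mathbb{S}^d$.
   Context: For a metric space $(\Omega,\rho)$, a real function $g$ of the distance is called isotropic positive definite on $\Omega$ if for every $N\in\mathbb{N}$ and every set of $N$ distinct points $\{x_1,\dots,x_N\}\subset\Omega$, the symmetric matrix $\big(g(\rho(x_i,x_j))\big)_{i,j=1}^N$ is positive definite, i.e. $\mathbf{c}^T\big(g(\rho(x_i,x_j))\big)\mathbf{c}>0$ for all nonzero $\mathbf{c}\in\mathbb{R}^N$. On $\mathbb{R}^d$ the metric is the Euclidean distance. On the unit sphere $\mathbb{S}^d=\{x\in\mathbb{R}^{d+1}:|x|=1\}$ the metric is the geodesic distance $\rho(x,y)=\arccos(x\cdot y)\in[0,\pi]$. *)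

theory Defs
  imports "HOL-Analysis.Analysis"
begin

text \<open>
  An N by N matrix is represented by its entries \<open>A i j\<close> for \<open>i, j < N\<close>; entries and vector
  components at indices outside \<open>{..<N}\<close> are irrelevant. Positive definiteness is strict.
\<close>

definition pos_def_matrix :: "nat \<Rightarrow> (nat \<Rightarrow> nat \<Rightarrow> real) \<Rightarrow> bool" where
  "pos_def_matrix N A \<longleftrightarrow>
     (\<forall>c :: nat \<Rightarrow> real. (\<exists>i<N. c i \<noteq> 0) \<longrightarrow> (\<Sum>i<N. \<Sum>j<N. c i * A i j * c j) > 0)"

text \<open>
  The distance \<open>\<rho>\<close> is an explicit argument because the unit sphere carries the geodesic
  distance rather than the \<^const>\<open>dist\<close> inherited from the ambient space.
\<close>

definition isotropic_pos_def_on ::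
    "'a set \<Rightarrow> ('a \<Rightarrow> 'a \<Rightarrow> real) \<Rightarrow> (real \<Rightarrow> real) \<Rightarrow> bool" where
  "isotropic_pos_def_on \<Omega> \<rho> g \<longleftrightarrow>
     (\<forall>N. \<forall>x :: nat \<Rightarrow> 'a. inj_on x {..<N} \<and> x ` {..<N} \<subseteq> \<Omega> \<longrightarrow>
        pos_def_matrix N (\<lambda>i j. g (\<rho> (x i) (x j))))"

definition geodesic_dist :: "'a::real_inner \<Rightarrow> 'a \<Rightarrow> real" where
  "geodesic_dist x y = arccos (x \<bullet> y)"

end

theory Submission
  imports Defs
begin

text \<open>
  Let \<open>d = 2 L + 1\<close>, let \<open>f w\<close> be the integral of \<open>cos (w t) * g t\<close> over \<open>[0, \<pi>]\<close>, and let \<open>D\<close> be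
  the operator \<open>-(1/w) d/dw\<close>, which is \<open>-2\<close> times differentiation with respect to \<open>w\<^sup>2\<close>.

  On the Euclidean side, \<open>F j = D\<^sup>j f\<close> is, up to a positive factor, the Fourier transform of
  \<open>x \<mapsto> g |x|\<close> on the space of dimension \<open>2 j + 1\<close>. Positive definiteness of \<open>g\<close> in dimension
  \<open>d\<close>, hence in all smaller dimensions, therefore gives \<open>F j \<ge> 0\<close> for \<open>j \<le> L\<close>. This is proved
  without Fourier analysis in several variables: integrating out two coordinates turns the
  profile \<open>H\<close> of a positive semidefinite radial kernel, written as a function of the squared
  distance, into a multiple of its tail integral (\<open>radial_psd_tail_integral\<close>); on cosine
  transforms, taking tails is exactly \<open>D\<close> (\<open>DERIV_cos_transform\<close>); and in dimension one
  nonnegativity of the cosine transform is elementary (\<open>cos_transform_nonneg\<close>).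

  On the spherical side, because \<open>g\<close> is supported in \<open>[0, \<pi>]\<close>, the numbers \<open>f k\<close> for integer
  \<open>k\<close> are also the Fourier coefficients of the even \<open>2\<pi>\<close>-periodic extension of \<open>g\<close>. They are
  nonnegative, so the cosine series converges absolutely to \<open>g\<close>
  (\<open>cos_coeffs_summable\<close>, \<open>cos_series_inversion\<close>). Since \<open>d\<close> is odd, \<open>L\<close> summations by parts turn
  it into an expansion of \<open>g (arccos t)\<close> in Gegenbauer polynomials of the integer parameter
  \<open>L = (d - 1)/2\<close> (\<open>gegenbauer_series\<close>). The coefficient of degree \<open>n\<close> is a positive multiple of an
  iterated difference of \<open>f\<close> at \<open>n, n + 2, \<dots>, n + 2 L\<close>.

  The two sides meet in one observation: this iterated difference is, up to a factor of sign
  \<open>(-1)\<^sup>L\<close>, the divided difference of \<open>f\<close>, regarded as a function of \<open>w\<^sup>2\<close>, at the nodes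
  \<open>n\<^sup>2, (n + 2)\<^sup>2, \<dots>, (n + 2 L)\<^sup>2\<close>. By the mean value theorem for divided differences its sign is
  that of \<open>D\<^sup>L f = F L\<close> (\<open>diffq_mean_value\<close>). The transform \<open>F L\<close> does not vanish on any interval,
  since otherwise \<open>g = 0\<close>; hence every coefficient is strictly positive (\<open>diffq_pos\<close>).

  Gegenbauer polynomials of parameter \<open>L\<close> give positive semidefinite kernels on the sphere of
  dimension \<open>2 L + 1\<close> (\<open>gegenbauer_gram\<close>), so the quadratic form of \<open>g\<close> is a sum of nonnegative
  terms. If it vanished, every Gegenbauer form and with it the form of every power of the inner
  product would vanish; for high powers this form is governed by the diagonal, which is
  impossible (\<open>power_forms_not_all_zero\<close>).
\<close>

section \<open>Gegenbauer polynomials\<close>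

text \<open>
  These are the classical Gegenbauer (ultraspherical) polynomials of parameter \<open>a\<close>. They are
  generated by their raising operator and not by the three-term recurrence because the same
  operator, acting in both arguments of a kernel, produces the Gram representation in
  \<open>gegenbauer_gram\<close>.
\<close>

fun gegenbauer :: "real \<Rightarrow> nat \<Rightarrow> real poly" where
  "gegenbauer a 0 = 1"
| "gegenbauer a (Suc n) = smult (1 / (real n + 1))
     (smult (2 * a + real n) ([:0, 1:] * gegenbauer a n) - [:1, 0, -1:] * pderiv (gegenbauer a n))"

lemma gegenbauer_raise:
  "(real n + 1) * poly (gegenbauer a (Suc n)) t =
     (2 * a + real n) * t * poly (gegenbauer a n) t - (1 - t\<^sup>2) * poly (pderiv (gegenbauer a n)) t"
  by (simp add: field_simps power2_eq_square)

lemma gegenbauer_raise_deriv: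
  "(real n + 1) * poly (pderiv (gegenbauer a (Suc n))) t =
     (2 * a + real n) * (poly (gegenbauer a n) t + t * poly (pderiv (gegenbauer a n)) t)
       + 2 * t * poly (pderiv (gegenbauer a n)) t - (1 - t\<^sup>2) * poly
           (pderiv (pderiv (gegenbauer a n))) t"
proof -
  have "smult (real n + 1) (gegenbauer a (Suc n)) =
    smult (2 * a + real n) ([:0, 1:] * gegenbauer a n) - [:1, 0, -1:] * pderiv (gegenbauer a n)"
    by simp
  then have "pderiv (smult (real n + 1) (gegenbauer a (Suc n))) =
    pderiv (smult (2 * a + real n) ([:0, 1:] * gegenbauer a n) - [:1, 0, -1:] * pderiv (gegenbauer a n))"
    by (rule arg_cong)
  then have "poly (pderiv (smult (real n + 1) (gegenbauer a (Suc n)))) t =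
    poly (pderiv (smult (2 * a + real n) ([:0, 1:] * gegenbauer a n) - [:1, 0, -1:] * pderiv (gegenbauer a n))) t"
    by (rule arg_cong)
  then show ?thesis
    by (simp only: pderiv_smult pderiv_diff pderiv_mult pderiv_pCons)
      (simp add: algebra_simps power2_eq_square)
qed

lemma gegenbauer_1: "gegenbauer a (Suc 0) = [:0, 2 * a:]"
  by simp

declare gegenbauer.simps(2) [simp del] gegenbauer_1 [simp]

text \<open>
  The Gegenbauer differential equation and the formula for the derivative are proved together:
  the equation in degree \<open>n\<close>, inserted into the derivative of the raising formula, gives the
  second identity, and the two combined give the equation in degree \<open>n + 1\<close>.
\<close>

lemma gegenbauer_ode_deriv:
  "(1 - t\<^sup>2) * poly (pderiv (pderiv (gegenbauer a n))) t =
     (2 * a + 1) * t * poly (pderiv (gegenbauer a n)) t -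
       real n * (real n + 2 * a) * poly (gegenbauer a n) t
   \<and> poly (pderiv (gegenbauer a (Suc n))) t =
     (real n + 2 * a) * poly (gegenbauer a n) t + t * poly (pderiv (gegenbauer a n)) t"
proof (induction n arbitrary: t)
  case 0
  show ?case by (simp add: pderiv_mult pderiv_smult pderiv_diff pderiv_pCons pderiv_1)
next
  case (Suc n)
  define c c1 c2 where "c = poly (gegenbauer a n) t" and "c1 = poly (pderiv (gegenbauer a n)) t"
    and "c2 = poly (pderiv (pderiv (gegenbauer a n))) t"
  define e e1 e2 where "e = poly (gegenbauer a (Suc n)) t"
      and "e1 = poly (pderiv (gegenbauer a (Suc n))) t"
    and "e2 = poly (pderiv (pderiv (gegenbauer a (Suc n)))) t"
  have ode: "(1 - t\<^sup>2) * c2 = (2 * a + 1) * t * c1 - real n * (real n + 2 * a) * c"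
    using Suc.IH[of t] by (simp only: c_def c1_def c2_def)
  have e: "(real n + 1) * e = (2 * a + real n) * t * c - (1 - t\<^sup>2) * c1"
    unfolding e_def c_def c1_def by (rule gegenbauer_raise)
  have e1: "e1 = (real n + 2 * a) * c + t * c1"
    using Suc.IH[of t] by (simp only: c_def c1_def e1_def)
  have "pderiv (gegenbauer a (Suc n)) = smult (real n + 2 * a) (gegenbauer a n) +
      [:0, 1:] * pderiv (gegenbauer a n)"
    by (rule poly_ext) (use Suc.IH in \<open>simp add: algebra_simps\<close>)
  then have e2: "e2 = (real n + 2 * a + 1) * c1 + t * c2"
    unfolding e2_def c1_def c2_def
    by (simp only: pderiv_add pderiv_smult pderiv_mult pderiv_pCons) (simp add: algebra_simps)
  have ode': "(1 - t\<^sup>2) * e2 = (2 * a + 1) * t * e1 - real (Suc n) * (real (Suc n) + 2 * a) * e"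
  proof -
    have "real (Suc n) * (real (Suc n) + 2 * a) * e = (real n + 1 + 2 * a) * ((real n + 1) * e)"
        by (simp add: algebra_simps)
    moreover have "(1 - t\<^sup>2) * e2 = (real n + 2 * a + 1) * (1 - t\<^sup>2) * c1 + t * ((1 - t\<^sup>2) * c2)"
      unfolding e2 by (simp add: algebra_simps)
    ultimately show ?thesis unfolding ode e e1 by (simp add: algebra_simps power2_eq_square)
  qed
  have "(real n + 2) * poly (pderiv (gegenbauer a (Suc (Suc n)))) t =
     (2 * a + real (Suc n)) * (e + t * e1) + 2 * t * e1 - (1 - t\<^sup>2) * e2"
    using gegenbauer_raise_deriv[of "Suc n" a t] by (simp add: e_def e1_def e2_def add.commute[of 2])
  also have "\<dots> = (real n + 2) * ((real (Suc n) + 2 * a) * e + t * e1)"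
    unfolding ode' by (simp add: algebra_simps)
  finally have "poly (pderiv (gegenbauer a (Suc (Suc n)))) t = (real (Suc n) + 2 * a) * e + t * e1"
    by simp
  with ode' show ?case by (simp only: e_def e1_def e2_def)
qed

lemmas gegenbauer_ode = gegenbauer_ode_deriv[THEN conjunct1]

lemmas gegenbauer_deriv_Suc = gegenbauer_ode_deriv[THEN conjunct2]

lemma gegenbauer_deriv_down:
  "poly (pderiv (gegenbauer a n)) t =
     t * poly (pderiv (gegenbauer a (Suc n))) t - (real n + 1) * poly (gegenbauer a (Suc n)) t"
  using gegenbauer_raise[of n a t] unfolding gegenbauer_deriv_Suc[of a n t]
  by (simp add: algebra_simps power2_eq_square)

lemma gegenbauer_recurrence:
  "2 * (real n + 1 + a) * t * poly (gegenbauer a (Suc n)) t =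
     (real n + 2) * poly (gegenbauer a (Suc (Suc n))) t + (real n + 2 * a) * poly (gegenbauer a n) t"
proof -
  have "(real n + 2) * poly (gegenbauer a (Suc (Suc n))) t =
     (2 * a + real n + 1) * t * poly (gegenbauer a (Suc n)) t - (1 - t\<^sup>2) * poly
         (pderiv (gegenbauer a (Suc n))) t"
    using gegenbauer_raise[of "Suc n" a t] by (simp add: add_ac)
  moreover have "(real n + 2 * a) * poly (gegenbauer a n) t =
     (1 - t\<^sup>2) * poly (pderiv (gegenbauer a (Suc n))) t +
         (real n + 1) * t * poly (gegenbauer a (Suc n)) t"
  proof -
    have "(real n + 2 * a) * poly (gegenbauer a n) t =
       poly (pderiv (gegenbauer a (Suc n))) t - t * poly (pderiv (gegenbauer a n)) t"
      unfolding gegenbauer_deriv_Suc[of a n t] by simp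
    then show ?thesis
      unfolding gegenbauer_deriv_down[of a n t] by (simp add: algebra_simps power2_eq_square)
  qed
  ultimately show ?thesis by (simp add: algebra_simps)
qed

lemma pderiv_gegenbauer: "poly (pderiv (gegenbauer a (Suc n))) t = 2 * a * poly (gegenbauer (a + 1) n) t"
proof (induction n arbitrary: t)
  case 0
  show ?case by (simp add: pderiv_mult pderiv_smult pderiv_diff pderiv_pCons pderiv_1)
next
  case (Suc n)
  have "pderiv (gegenbauer a (Suc n)) = smult (2 * a) (gegenbauer (a + 1) n)"
    by (rule poly_ext) (simp add: Suc.IH)
  then have D: "poly (pderiv (pderiv (gegenbauer a (Suc n)))) t =
      2 * a * poly (pderiv (gegenbauer (a + 1) n)) t"
    by (simp add: pderiv_smult)
  have "(real n + 1) * (2 * a * poly (gegenbauer (a + 1) (Suc n)) t) =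
     2 * a * ((2 * (a + 1) + real n) * t * poly (gegenbauer (a + 1) n) t - (1 - t\<^sup>2) * poly
         (pderiv (gegenbauer (a + 1) n)) t)"
    unfolding gegenbauer_raise[symmetric] by simp
  also have "\<dots> = (2 * (a + 1) + real n) * t * poly (pderiv (gegenbauer a (Suc n))) t
      - (1 - t\<^sup>2) * poly (pderiv (pderiv (gegenbauer a (Suc n)))) t"
    unfolding D Suc.IH by (simp add: algebra_simps)
  also have "\<dots> = (real n + 1) * poly (pderiv (gegenbauer a (Suc (Suc n)))) t"
    using gegenbauer_ode[of t a "Suc n"] gegenbauer_deriv_Suc[of a "Suc n" t]
        by (simp add: algebra_simps)
  finally show ?case by simp
qed

text \<open>
  This contiguity relation raises the parameter by one at the price of a difference of degrees
  \<open>n\<close> and \<open>n - 2\<close>. Each summation by parts in \<open>gegenbauer_series\<close> uses it once. It holds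
  because both sides are the difference of the derivatives in degrees \<open>n + 1\<close> and \<open>n - 1\<close>.
\<close>

lemma gegenbauer_param_Suc:
  assumes "a \<noteq> 0"
  shows "a * (poly (gegenbauer (a + 1) n) t -
      (if n < 2 then 0 else poly (gegenbauer (a + 1) (n - 2)) t)) =
     (real n + a) * poly (gegenbauer a n) t"
proof (cases "n < 2")
  case True
  then consider "n = 0" | "n = 1" by linarith
  then show ?thesis by cases (simp_all add: algebra_simps)
next
  case False
  define m where "m = n - 2"
  have n: "n = Suc (Suc m)" using False by (simp add: m_def)
  have "2 * a * (poly (gegenbauer (a + 1) n) t - poly (gegenbauer (a + 1) m) t) =
     poly (pderiv (gegenbauer a (Suc n))) t - poly (pderiv (gegenbauer a (Suc m))) t"
    by (simp add: pderiv_gegenbauer algebra_simps)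
  also have "\<dots> = 2 * ((real n + a) * poly (gegenbauer a n) t)"
    unfolding gegenbauer_deriv_down[of a "Suc m"] n
    by (simp add: algebra_simps gegenbauer_deriv_Suc[of a "Suc (Suc m)"])
  finally show ?thesis by (simp add: n)
qed

lemma gegenbauer_1_recurrence:
  "poly (gegenbauer 1 (Suc (Suc n))) t = 2 * t * poly (gegenbauer 1 (Suc n)) t - poly (gegenbauer 1 n) t"
proof -
  have "(real n + 2) * poly (gegenbauer 1 (Suc (Suc n))) t =
     (real n + 2) * (2 * t * poly (gegenbauer 1 (Suc n)) t - poly (gegenbauer 1 n) t)"
    using gegenbauer_recurrence[of n 1 t] by (simp add: algebra_simps)
  then show ?thesis by (simp)
qed

text \<open>
  For parameter 1 the polynomials are the Chebyshev polynomials of the second kind, and the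
  differences are the terms of a cosine series. This is the first link between cosine series and
  Gegenbauer series.
\<close>

lemma gegenbauer_1_cos:
  "poly (gegenbauer 1 n) (cos x) - (if n < 2 then 0 else poly (gegenbauer 1 (n - 2)) (cos x)) =
     (if n = 0 then 1 else 2 * cos (real n * x))"
proof -
  have *: "poly (gegenbauer 1 (Suc n)) (cos x) - cos x * poly (gegenbauer 1 n) (cos x) =
      cos ((real n + 1) * x)" for n
  proof (induction n rule: induct_nat_012)
    case 0 show ?case by simp
  next
    case 1 show ?case
      by (simp add: gegenbauer_1_recurrence cos_double_cos power2_eq_square)
  next
    case (ge2 n)
    define u0 u1 u2 u3 where "u0 = poly (gegenbauer 1 n) (cos x)"
        and "u1 = poly (gegenbauer 1 (Suc n)) (cos x)"
      and "u2 = poly (gegenbauer 1 (Suc (Suc n))) (cos x)"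
          and "u3 = poly (gegenbauer 1 (Suc (Suc (Suc n)))) (cos x)"
    have ar: "((real n + 3) * x + (real n + 1) * x) / 2 = (real n + 2) * x"
      "((real n + 3) * x - (real n + 1) * x) / 2 = x" by (simp_all add: algebra_simps)
    have c: "cos ((real n + 3) * x) = 2 * cos x * cos ((real n + 2) * x) - cos ((real n + 1) * x)"
      using cos_plus_cos[of "(real n + 3) * x" "(real n + 1) * x"] unfolding ar by algebra
    have "u3 - cos x * u2 = 2 * cos x * (u2 - cos x * u1) - (u1 - cos x * u0)"
      using gegenbauer_1_recurrence[of n "cos x"] gegenbauer_1_recurrence[of "Suc n" "cos x"]
      unfolding u0_def[symmetric] u1_def[symmetric] u2_def[symmetric] u3_def[symmetric]
      by algebra
    also have "\<dots> = cos ((real n + 3) * x)"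
      using ge2 unfolding c u0_def[symmetric] u1_def[symmetric] u2_def[symmetric]
      by (simp add: algebra_simps)
    finally show ?case unfolding u2_def u3_def by (simp add: algebra_simps)
  qed
  show ?thesis
  proof (cases "n < 2")
    case True
    then consider "n = 0" | "n = 1" by linarith
    then show ?thesis by cases simp_all
  next
    case False
    define m where "m = n - 2"
    have n: "n = Suc (Suc m)" using False by (simp add: m_def)
    show ?thesis using *[of "Suc m"] gegenbauer_1_recurrence[of m "cos x"]
      by (simp add: n algebra_simps)
  qed
qed

section \<open>Gegenbauer kernels on spheres\<close>

lemma real_polynomial_function_derivative:
  fixes p :: "'a::euclidean_space \<Rightarrow> real"
  assumes "real_polynomial_function p"
  shows "\<exists>D. (\<forall>x. (p has_derivative D x) (at x)) \<and> (\<forall>v. real_polynomial_function (\<lambda>x. D x v))"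
  using assms
proof induction
  case (linear f)
  have "(f has_derivative f) (at x)" for x using linear by (rule bounded_linear_imp_has_derivative)
  then show ?case by (intro exI[of _ "\<lambda>_. f"]) (auto intro: real_polynomial_function.intros)
next
  case (const c)
  show ?case by (rule exI[of _ "\<lambda>_ _. 0"]) (auto intro: real_polynomial_function.intros)
next
  case (add f g)
  then obtain D E where "\<forall>x. (f has_derivative D x) (at x)" "\<forall>v. real_polynomial_function (\<lambda>x. D x v)"
    "\<forall>x. (g has_derivative E x) (at x)" "\<forall>v. real_polynomial_function (\<lambda>x. E x v)"
    by blast
  then show ?case
    by (intro exI[of _ "\<lambda>x v. D x v + E x v"])
      (auto intro!: has_derivative_add intro: real_polynomial_function.intros)
next
  case (mult f g)
  then obtain D E where "\<forall>x. (f has_derivative D x) (at x)" "\<forall>v. real_polynomial_function (\<lambda>x. D x v)"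
    "\<forall>x. (g has_derivative E x) (at x)" "\<forall>v. real_polynomial_function (\<lambda>x. E x v)"
    by blast
  then show ?case using mult.hyps
    by (intro exI[of _ "\<lambda>x v. f x * E x v + D x v * g x"])
      (auto intro!: has_derivative_mult real_polynomial_function.intros(3,4))
qed

text \<open>
  A curve through \<open>x\<close> on the unit sphere, whose velocity at \<open>0\<close> is the tangential part of \<open>e\<close>.
  Differentiating along it makes sense of tangential derivatives for identities that are known
  only on the sphere.
\<close>

definition sphere_curve :: "'a::euclidean_space \<Rightarrow> 'a \<Rightarrow> real \<Rightarrow> 'a" where
  "sphere_curve x e h = (x + h *\<^sub>R e) /\<^sub>R norm (x + h *\<^sub>R e)"

lemma sphere_curve_0: "norm x = 1 \<Longrightarrow> sphere_curve x e 0 = x"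
  by (simp add: sphere_curve_def)

lemma sphere_curve_in_sphere:
  assumes "norm x = 1"
  shows "\<forall>\<^sub>F h in at 0. norm (sphere_curve x e h) = 1"
proof -
  have "((\<lambda>h. x + h *\<^sub>R e) \<longlongrightarrow> x + 0 *\<^sub>R e) (at 0)"
    by (intro tendsto_intros)
  then have "\<forall>\<^sub>F h in at 0. x + h *\<^sub>R e \<noteq> 0"
    using assms by (intro tendsto_imp_eventually_ne) auto
  then show ?thesis by eventually_elim (simp add: sphere_curve_def)
qed

lemma sphere_curve_vector_derivative:
  assumes "norm x = 1"
  shows "(sphere_curve x e has_vector_derivative e - (x \<bullet> e) *\<^sub>R x) (at 0)"
proof -
  have "x \<noteq> 0" "x \<bullet> x = 1" using assms by (auto simp: norm_eq_1)
  then have "norm (x + h *\<^sub>R e) = sqrt (1 + 2 * h * (x \<bullet> e) + h\<^sup>2 * (e \<bullet> e))" for h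
    by (simp add: norm_eq_sqrt_inner inner_add_left inner_add_right inner_commute algebra_simps
        power2_eq_square)
  then have "((\<lambda>h. norm (x + h *\<^sub>R e)) has_real_derivative x \<bullet> e) (at 0)"
    by (auto intro!: derivative_eq_intros)
  then have "((\<lambda>h. inverse (norm (x + h *\<^sub>R e))) has_real_derivative - (x \<bullet> e)) (at 0)"
    using assms by (auto intro!: derivative_eq_intros simp: DERIV_inverse' )
  moreover have "((\<lambda>h. x + h *\<^sub>R e) has_vector_derivative e) (at 0)"
    by (auto intro!: derivative_eq_intros)
  ultimately have "((\<lambda>h. inverse (norm (x + h *\<^sub>R e)) *\<^sub>R (x + h *\<^sub>R e)) has_vector_derivative
      inverse (norm (x + 0 *\<^sub>R e)) *\<^sub>R e + - (x \<bullet> e) *\<^sub>R (x + 0 *\<^sub>R e)) (at 0)"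
    by (rule has_vector_derivative_scaleR)
  then show ?thesis using assms by (simp add: sphere_curve_def[abs_def])
qed

text \<open>
  Closure under tangential derivatives is what allows the construction of Gram representations in
  \<open>gegenbauer_gram\<close> to be iterated.
\<close>

lemma sphere_gradient_polynomial:
  fixes p :: "'a::euclidean_space \<Rightarrow> real"
  assumes "real_polynomial_function p"
  shows "\<exists>q. real_polynomial_function q \<and>
    (\<forall>x. norm x = 1 \<longrightarrow> ((\<lambda>h. p (sphere_curve x e h)) has_real_derivative q x) (at 0))"
proof -
  obtain D where D: "\<And>x. (p has_derivative D x) (at x)" "\<And>v. real_polynomial_function (\<lambda>x. D x v)"
    using real_polynomial_function_derivative[OF assms] by blast
  have lin: "bounded_linear (\<lambda>x. x \<bullet> b)" for b :: 'a by (rule bounded_linear_inner_left)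
  define q where "q x = D x e - (x \<bullet> e) * (\<Sum>b\<in>Basis. (x \<bullet> b) * D x b)" for x
  have "real_polynomial_function q"
    unfolding q_def[abs_def]
    by (intro real_polynomial_function_diff real_polynomial_function.intros(4)
        real_polynomial_function_sum
        real_polynomial_function.intros(1) lin D) auto
  moreover have "((\<lambda>h. p (sphere_curve x e h)) has_real_derivative q x) (at 0)" if x: "norm x = 1" for x
  proof -
    have "(p has_derivative D x) (at (sphere_curve x e 0))" using D(1) x by (simp add: sphere_curve_0)
    from vector_derivative_diff_chain_within[OF sphere_curve_vector_derivative[OF x]
        has_derivative_at_withinI[OF this]]
    have *: "((p \<circ> sphere_curve x e) has_vector_derivative D x (e - (x \<bullet> e) *\<^sub>R x)) (at 0)" .
    interpret L: bounded_linear "D x" using D(1) has_derivative_bounded_linear by blast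
    have "D x x = D x (\<Sum>b\<in>Basis. (x \<bullet> b) *\<^sub>R b)" by (simp add: euclidean_representation)
    also have "\<dots> = (\<Sum>b\<in>Basis. (x \<bullet> b) * D x b)" by (simp add: L.sum L.scaleR)
    finally have "D x (e - (x \<bullet> e) *\<^sub>R x) = q x" by (simp add: q_def L.diff L.scaleR)
    with * show ?thesis by (simp add: has_real_derivative_iff_has_vector_derivative o_def)
  qed
  ultimately show ?thesis by blast
qed

lemma sum_list_has_real_derivative:
  assumes "\<And>p. p \<in> set ps \<Longrightarrow> (f p has_real_derivative f' p) (at x)"
  shows "((\<lambda>h. \<Sum>p\<leftarrow>ps. f p h) has_real_derivative (\<Sum>p\<leftarrow>ps. f' p)) (at x)"
  using assms by (induction ps) (auto intro!: derivative_eq_intros)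

lemma DERIV_cong_eventually_at:
  fixes f g :: "real \<Rightarrow> real"
  assumes "\<forall>\<^sub>F h in at 0. f h = g h" "f 0 = g 0" "(f has_real_derivative D) (at 0)"
  shows "(g has_real_derivative D) (at 0)"
  using assms(3) has_field_derivative_cong_eventually[OF assms(1,2)] by simp

text \<open>
  On the unit sphere of a space of dimension \<open>2 a + 2\<close> the Gegenbauer kernel of degree \<open>n\<close> is, up
  to a positive factor, the Gram kernel of finitely many polynomials. If \<open>p\<close> runs through such
  polynomials in degree \<open>n\<close>, then \<open>(2 a + n) (x \<bullet> e) p - T\<^sub>e p\<close>, with \<open>T\<^sub>e\<close> the tangential derivative
  in direction \<open>e\<close> and \<open>e\<close> running through the basis, serve in degree \<open>n + 1\<close>: up to a factor,
  this is the harmonic projection of \<open>(x \<bullet> e) p\<close>, restricted to the sphere. The new Gram kernel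
      depends only on
  \<open>x \<bullet> y\<close>, and the differential equation reduces it to the raising formula.
\<close>

lemma gegenbauer_gram:
  fixes a :: real
  assumes a: "real DIM('a::euclidean_space) = 2 * a + 2" and "a > 0"
  shows "\<exists>ps :: ('a \<Rightarrow> real) list. (\<forall>p\<in>set ps. real_polynomial_function p) \<and>
    (\<exists>c>0. \<forall>x y. norm x = 1 \<longrightarrow> norm y = 1 \<longrightarrow> (\<Sum>p\<leftarrow>ps. p x * p y) = c * poly (gegenbauer a n) (x \<bullet> y))"
proof (induction n)
  case 0
  show ?case by (intro exI[of _ "[\<lambda>_. 1]"] conjI exI[of _ 1])
      (auto intro: real_polynomial_function.intros)
next
  case (Suc n)
  then obtain ps :: "('a \<Rightarrow> real) list" and c where ps: "\<And>p. p \<in> set ps \<Longrightarrow> real_polynomial_function p"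
    and "c > 0"
    and gram: "\<And>x y. norm x = 1 \<Longrightarrow> norm y = 1 \<Longrightarrow> (\<Sum>p\<leftarrow>ps. p x * p y) = c * poly (gegenbauer a n) (x \<bullet> y)"
    by blast
  define T where "T e p = (SOME q. real_polynomial_function q \<and>
    (\<forall>x. norm x = 1 \<longrightarrow> ((\<lambda>h. p (sphere_curve x e h)) has_real_derivative q x) (at 0)))"
    for e :: 'a and p
  have T: "real_polynomial_function (T e p)"
    and DT: "norm x = 1 \<Longrightarrow> ((\<lambda>h. p (sphere_curve x e h)) has_real_derivative T e p x) (at 0)"
    if "p \<in> set ps" for e p x
    using someI_ex[OF sphere_gradient_polynomial[OF ps[OF that], of e]] unfolding T_def by blast+
  define C C1 C2 where "C = poly (gegenbauer a n)" and "C1 = poly (pderiv (gegenbauer a n))"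
    and "C2 = poly (pderiv (pderiv (gegenbauer a n)))"
  have DC [derivative_intros]: "(C has_real_derivative C1 t) (at t within S)"
      "(C1 has_real_derivative C2 t) (at t within S)" for t S
    unfolding C_def C1_def C2_def by (auto intro: poly_DERIV has_field_derivative_at_within)
  have Dinner: "((\<lambda>h. sphere_curve x e h \<bullet> y) has_real_derivative (e \<bullet> y - (x \<bullet> e) * (x \<bullet> y))) (at 0)"
    if "norm x = 1" for x y e :: 'a
  proof -
    have "((\<lambda>h. sphere_curve x e h \<bullet> y) has_vector_derivative ((e - (x \<bullet> e) *\<^sub>R x) \<bullet> y)) (at 0)"
      using bounded_linear.has_vector_derivative[OF bounded_linear_inner_left
          sphere_curve_vector_derivative[OF that]] .
    then show ?thesis by (simp add: has_real_derivative_iff_has_vector_derivative inner_diff_left)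
  qed
  \<comment> \<open>The identity for the Gram kernel is differentiated once in \<open>x\<close> and then once in \<open>y\<close>.\<close>
  have T1: "(\<Sum>p\<leftarrow>ps. T e p x * p y) = c * (C1 (x \<bullet> y) * (e \<bullet> y - (x \<bullet> e) * (x \<bullet> y)))"
    if xy: "norm x = 1" "norm y = 1" for x y e
  proof (rule DERIV_unique)
    show "((\<lambda>h. \<Sum>p\<leftarrow>ps. p (sphere_curve x e h) * p y) has_real_derivative (\<Sum>p\<leftarrow>ps. T e p x * p y)) (at 0)"
      by (intro sum_list_has_real_derivative DERIV_cmult_right DT xy)
    have "((\<lambda>h. c * C (sphere_curve x e h \<bullet> y)) has_real_derivative
       c * (C1 (x \<bullet> y) * (e \<bullet> y - (x \<bullet> e) * (x \<bullet> y)))) (at 0)"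
      by (intro DERIV_cmult DERIV_chain2[OF _ Dinner]) (use xy DC in \<open>auto simp: sphere_curve_0\<close>)
    then show "((\<lambda>h. \<Sum>p\<leftarrow>ps. p (sphere_curve x e h) * p y) has_real_derivative
       c * (C1 (x \<bullet> y) * (e \<bullet> y - (x \<bullet> e) * (x \<bullet> y)))) (at 0)"
    proof (rule DERIV_cong_eventually_at[rotated 2])
      show "\<forall>\<^sub>F h in at 0. c * C (sphere_curve x e h \<bullet> y) = (\<Sum>p\<leftarrow>ps. p (sphere_curve x e h) * p y)"
        using sphere_curve_in_sphere[OF xy(1), of e] by eventually_elim (simp add: gram xy C_def)
    qed (simp add: sphere_curve_0 gram xy C_def)
  qed
  have T2: "(\<Sum>p\<leftarrow>ps. T e p x * T e p y) =
      c * (C2 (x \<bullet> y) * (e \<bullet> x - (y \<bullet> e) * (x \<bullet> y)) * (e \<bullet> y - (x \<bullet> e) * (x \<bullet> y)) +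
           C1 (x \<bullet> y) * (e \<bullet> e - (y \<bullet> e)\<^sup>2 - (x \<bullet> e) * (e \<bullet> x - (y \<bullet> e) * (x \<bullet> y))))" (is "_ = ?D")
    if xy: "norm x = 1" "norm y = 1" for x y e
  proof (rule DERIV_unique)
    show "((\<lambda>h. \<Sum>p\<leftarrow>ps. T e p x * p (sphere_curve y e h)) has_real_derivative
        (\<Sum>p\<leftarrow>ps. T e p x * T e p y)) (at 0)"
      by (intro sum_list_has_real_derivative DERIV_cmult DT xy)
    have "((\<lambda>h. c * (C1 (sphere_curve y e h \<bullet> x) * (sphere_curve y e h \<bullet> e - (x \<bullet> e) * (sphere_curve y e h \<bullet> x)))) has_real_derivative
       ?D) (at 0)"
      by (rule derivative_eq_intros DERIV_chain2[OF _ Dinner] Dinner xy DC refl)+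
        (use xy in \<open>simp add: sphere_curve_0 inner_commute algebra_simps power2_eq_square\<close>)
    then show "((\<lambda>h. \<Sum>p\<leftarrow>ps. T e p x * p (sphere_curve y e h)) has_real_derivative ?D) (at 0)"
    proof (rule DERIV_cong_eventually_at[rotated 2])
      show "\<forall>\<^sub>F h in at 0. c * (C1 (sphere_curve y e h \<bullet> x) *
          (sphere_curve y e h \<bullet> e - (x \<bullet> e) * (sphere_curve y e h \<bullet> x))) =
              (\<Sum>p\<leftarrow>ps. T e p x * p (sphere_curve y e h))"
        using sphere_curve_in_sphere[OF xy(2), of e] by eventually_elim (simp add: T1 xy inner_commute)
    qed (simp add: sphere_curve_0 T1 xy inner_commute)
  qed
  obtain bs :: "'a list" where bs: "set bs = Basis" "distinct bs"
      using finite_distinct_list[OF finite_Basis] by blast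
  define b where "b = 2 * a + n"
  define qs where "qs = concat (map (\<lambda>e. map (\<lambda>p x. b * (x \<bullet> e) * p x - T e p x) ps) bs)"
  have "real_polynomial_function p" if "p \<in> set qs" for p
    using that ps T unfolding qs_def
    by (auto intro!: real_polynomial_function_diff real_polynomial_function.intros(4)
       intro: real_polynomial_function.intros bounded_linear_inner_left)
  moreover have "(\<Sum>p\<leftarrow>qs. p x * p y) =
      (c * (2 * a + 2 * n) * (n + 1)) * poly (gegenbauer a (Suc n)) (x \<bullet> y)"
    if xy: "norm x = 1" "norm y = 1" for x y
  proof -
    define t where "t = x \<bullet> y"
    have "(\<Sum>p\<leftarrow>qs. p x * p y) = (\<Sum>e\<leftarrow>bs. \<Sum>p\<leftarrow>ps. (b * (x \<bullet> e) * p x - T e p x) *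
        (b * (y \<bullet> e) * p y - T e p y))"
      unfolding qs_def by (induction bs) (simp_all add: o_def)
    also have "\<dots> = (\<Sum>e\<in>Basis. \<Sum>p\<leftarrow>ps. (b * (x \<bullet> e) * p x - T e p x) * (b * (y \<bullet> e) * p y - T e p y))"
      using bs by (simp add: sum_list_distinct_conv_sum_set)
    also have "\<dots> = (\<Sum>e\<in>Basis. b\<^sup>2 * (x \<bullet> e) * (y \<bullet> e) * (\<Sum>p\<leftarrow>ps. p x * p y)
        - b * (x \<bullet> e) * (\<Sum>p\<leftarrow>ps. T e p y * p x) - b * (y \<bullet> e) * (\<Sum>p\<leftarrow>ps. T e p x * p y)
        + (\<Sum>p\<leftarrow>ps. T e p x * T e p y))"
    proof (rule sum.cong)
      fix e :: 'a
      show "(\<Sum>p\<leftarrow>ps. (b * (x \<bullet> e) * p x - T e p x) * (b * (y \<bullet> e) * p y - T e p y)) =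
       b\<^sup>2 * (x \<bullet> e) * (y \<bullet> e) * (\<Sum>p\<leftarrow>ps. p x * p y)
        - b * (x \<bullet> e) * (\<Sum>p\<leftarrow>ps. T e p y * p x) - b * (y \<bullet> e) * (\<Sum>p\<leftarrow>ps. T e p x * p y)
        + (\<Sum>p\<leftarrow>ps. T e p x * T e p y)"
        by (induction ps) (simp_all add: algebra_simps power2_eq_square)
    qed simp
    also have "\<dots> = (\<Sum>e\<in>Basis. c * (b\<^sup>2 * C t * ((x \<bullet> e) * (y \<bullet> e))
        - b * C1 t * ((x \<bullet> e) * (x \<bullet> e) - t * ((x \<bullet> e) * (y \<bullet> e)))
        - b * C1 t * ((y \<bullet> e) * (y \<bullet> e) - t * ((x \<bullet> e) * (y \<bullet> e)))
        + C2 t * ((1 + t\<^sup>2) * ((x \<bullet> e) * (y \<bullet> e)) - t * ((x \<bullet> e) * (x \<bullet> e)) - t * ((y \<bullet> e) * (y \<bullet> e)))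
        + C1 t * (1 - (y \<bullet> e) * (y \<bullet> e) - (x \<bullet> e) * (x \<bullet> e) + t * ((x \<bullet> e) * (y \<bullet> e)))))"
    proof (rule sum.cong)
      fix e :: 'a assume "e \<in> Basis"
      then have ee: "e \<bullet> e = 1" by (simp add: inner_same_Basis)
      show "b\<^sup>2 * (x \<bullet> e) * (y \<bullet> e) * (\<Sum>p\<leftarrow>ps. p x * p y)
        - b * (x \<bullet> e) * (\<Sum>p\<leftarrow>ps. T e p y * p x) - b * (y \<bullet> e) * (\<Sum>p\<leftarrow>ps. T e p x * p y)
        + (\<Sum>p\<leftarrow>ps. T e p x * T e p y) =
        c * (b\<^sup>2 * C t * ((x \<bullet> e) * (y \<bullet> e))
        - b * C1 t * ((x \<bullet> e) * (x \<bullet> e) - t * ((x \<bullet> e) * (y \<bullet> e)))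
        - b * C1 t * ((y \<bullet> e) * (y \<bullet> e) - t * ((x \<bullet> e) * (y \<bullet> e)))
        + C2 t * ((1 + t\<^sup>2) * ((x \<bullet> e) * (y \<bullet> e)) - t * ((x \<bullet> e) * (x \<bullet> e)) - t * ((y \<bullet> e) * (y \<bullet> e)))
        + C1 t * (1 - (y \<bullet> e) * (y \<bullet> e) - (x \<bullet> e) * (x \<bullet> e) + t * ((x \<bullet> e) * (y \<bullet> e))))"
        unfolding T1[OF xy] T1[OF xy(2,1)] T2[OF xy] gram[OF xy] C_def[symmetric] t_def[symmetric]
          inner_commute[of y x] inner_commute[of e x] inner_commute[of e y]
        by (simp add: ee algebra_simps power2_eq_square)
    qed simp
    also have "\<dots> = c * (b\<^sup>2 * C t * t
        - b * C1 t * (1 - t * t) - b * C1 t * (1 - t * t)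
        + C2 t * ((1 + t\<^sup>2) * t - t * 1 - t * 1)
        + C1 t * (real DIM('a) - 1 - 1 + t * t))"
    proof -
      have "(\<Sum>e\<in>Basis. (x \<bullet> e) * (y \<bullet> e)) = t" "(\<Sum>e\<in>Basis. (x \<bullet> e) * (x \<bullet> e)) = 1"
        "(\<Sum>e\<in>Basis. (y \<bullet> e) * (y \<bullet> e)) = 1"
        using euclidean_inner[of x y] euclidean_inner[of x x] euclidean_inner[of y y] xy
        by (auto simp: t_def norm_eq_1)
      then show ?thesis
        by (simp only: sum_distrib_left[symmetric] sum.distrib sum_subtractf sum_constant) simp
    qed
    also have "\<dots> = c * (2 * a + 2 * n) * (b * t * C t - (1 - t\<^sup>2) * C1 t)"
    proof -
      have "(1 - t\<^sup>2) * C2 t = (2 * a + 1) * t * C1 t - n * b * C t"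
        unfolding C_def C1_def C2_def b_def gegenbauer_ode by (simp add: algebra_simps)
      moreover have "C2 t * ((1 + t\<^sup>2) * t - t * 1 - t * 1) = - t * ((1 - t\<^sup>2) * C2 t)"
        by (simp add: algebra_simps)
      ultimately have C2: "C2 t * ((1 + t\<^sup>2) * t - t * 1 - t * 1) =
          - t * ((2 * a + 1) * t * C1 t - n * b * C t)" by simp
      show ?thesis unfolding C2 a by (simp add: b_def algebra_simps power2_eq_square)
    qed
    finally show ?thesis
      unfolding C_def C1_def t_def b_def gegenbauer_raise[symmetric] by (simp add: algebra_simps)
  qed
  moreover have "c * (2 * a + 2 * n) * (n + 1) > 0" using \<open>c > 0\<close> \<open>a > 0\<close> by simp
  ultimately show ?case by blast
qed

lemma gegenbauer_form_nonneg:
  fixes x :: "nat \<Rightarrow> 'a::euclidean_space"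
  assumes a: "real DIM('a) = 2 * a + 2" "a > 0" and x: "\<And>i. i < N \<Longrightarrow> norm (x i) = 1"
  shows "0 \<le> (\<Sum>i<N. \<Sum>j<N. c i * c j * poly (gegenbauer a n) (x i \<bullet> x j))"
proof -
  obtain ps :: "('a \<Rightarrow> real) list" and d where d: "d > 0"
    and gram: "\<And>x y. norm x = 1 \<Longrightarrow> norm y = 1 \<Longrightarrow> (\<Sum>p\<leftarrow>ps. p x * p y) = d * poly (gegenbauer a n) (x \<bullet> y)"
    using gegenbauer_gram[OF a] by blast
  have "d * (\<Sum>i<N. \<Sum>j<N. c i * c j * poly (gegenbauer a n) (x i \<bullet> x j)) =
     (\<Sum>i<N. \<Sum>j<N. c i * c j * (\<Sum>p\<leftarrow>ps. p (x i) * p (x j)))"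
    by (simp add: gram x sum_distrib_left mult_ac)
  also have "\<dots> = (\<Sum>p\<leftarrow>ps. (\<Sum>i<N. c i * p (x i))\<^sup>2)"
    by (induction ps)
      (simp_all add: distrib_left sum.distrib power2_eq_square sum_product mult_ac)
  also have "\<dots> \<ge> 0" by (intro sum_list_nonneg) auto
  finally show ?thesis using d by (simp add: zero_le_mult_iff)
qed

text \<open>
  By the three-term recurrence, multiplication by \<open>t\<close> stays within the span of the Gegenbauer
  polynomials, and \<open>1\<close> is one of them.
\<close>

lemma gegenbauer_forms_determine_powers:
  fixes t :: "nat \<Rightarrow> nat \<Rightarrow> real"
  assumes a: "a > 0"
    and zero: "\<And>n. (\<Sum>i<N. \<Sum>j<N. c i * c j * poly (gegenbauer a n) (t i j)) = 0"
  shows "(\<Sum>i<N. \<Sum>j<N. c i * c j * t i j ^ k) = 0"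
proof -
  have "(\<Sum>i<N. \<Sum>j<N. c i * c j * t i j ^ k * poly (gegenbauer a n) (t i j)) = 0" for n
  proof (induction k arbitrary: n)
    case (Suc k)
    define Q where "Q n = (\<Sum>i<N. \<Sum>j<N. c i * c j * t i j ^ k * poly (gegenbauer a n) (t i j))" for n
    have Q: "Q n = 0" for n unfolding Q_def by (rule Suc)
    show ?case
    proof (cases n)
      case 0
      have "2 * a * (\<Sum>i<N. \<Sum>j<N. c i * c j * t i j ^ Suc k * poly (gegenbauer a n) (t i j)) = Q 1"
        unfolding Q_def 0 by (simp add: sum_distrib_left mult_ac)
      then show ?thesis using a Q by simp
    next
      case (Suc m)
      have "2 * (real m + 1 + a) * (\<Sum>i<N. \<Sum>j<N. c i * c j * t i j ^ Suc k * poly (gegenbauer a n)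
          (t i j)) =
        (\<Sum>i<N. \<Sum>j<N. c i * c j * t i j ^ k *
            (2 * (real m + 1 + a) * t i j * poly (gegenbauer a (Suc m)) (t i j)))"
        unfolding Suc by (simp add: sum_distrib_left mult_ac)
      also have "\<dots> = (real m + 2) * Q (Suc (Suc m)) + (real m + 2 * a) * Q m"
        unfolding gegenbauer_recurrence Q_def
        by (simp add: sum_distrib_left sum.distrib[symmetric] distrib_left mult_ac)
      also have "\<dots> = 0" using Q by simp
      finally show ?thesis using a by (simp add: mult_eq_0_iff)
    qed
  qed (use zero in simp)
  from this[of 0] show ?thesis by simp
qed

text \<open>
  The function \<open>t\<^sup>2\<^sup>k + t\<^sup>2\<^sup>k\<^sup>+\<^sup>1\<close> tends to \<open>0\<close> for \<open>-1 \<le> t < 1\<close>, also at the antipodal value \<open>-1\<close>, and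
  equals \<open>2\<close> at \<open>1\<close>. Its quadratic form therefore tends to twice the sum of the squares of the
  coefficients.
\<close>

lemma power_forms_not_all_zero:
  fixes t :: "nat \<Rightarrow> nat \<Rightarrow> real"
  assumes diag: "\<And>i. i < N \<Longrightarrow> t i i = 1"
    and off: "\<And>i j. i < N \<Longrightarrow> j < N \<Longrightarrow> i \<noteq> j \<Longrightarrow> - 1 \<le> t i j \<and> t i j < 1"
    and c: "i0 < N" "c i0 \<noteq> 0"
  shows "\<exists>k. (\<Sum>i<N. \<Sum>j<N. c i * c j * t i j ^ k) \<noteq> (0::real)"
proof (rule ccontr)
  assume "\<not> ?thesis"
  then have zero: "(\<Sum>i<N. \<Sum>j<N. c i * c j * t i j ^ k) = 0" for k by blast
  have lim: "(\<lambda>k. t i j ^ (2 * k) + t i j ^ (2 * k + 1)) \<longlonglongrightarrow> (if i = j then 2 else 0)"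
      if "i < N" "j < N" for i j
  proof (cases "i = j \<or> t i j = - 1")
    case True
    then show ?thesis using diag[OF that(1)] off[OF that] by auto
  next
    case False
    then have "\<bar>t i j\<bar> < 1" using off[OF that] by auto
    then have "(\<lambda>n. t i j ^ n) \<longlonglongrightarrow> 0" by (intro LIMSEQ_power_zero) simp
    from LIMSEQ_subseq_LIMSEQ[OF this, of "\<lambda>k. 2 * k"] LIMSEQ_subseq_LIMSEQ[OF this, of "\<lambda>k. 2 * k + 1"]
    have "(\<lambda>k. t i j ^ (2 * k) + t i j ^ (2 * k + 1)) \<longlonglongrightarrow> 0 + 0"
      by (intro tendsto_add) (auto simp: o_def strict_mono_def)
    then show ?thesis using False by simp
  qed
  have "(\<lambda>k. \<Sum>i<N. \<Sum>j<N. c i * c j * (t i j ^ (2 * k) + t i j ^ (2 * k + 1))) \<longlonglongrightarrow>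
      (\<Sum>i<N. \<Sum>j<N. c i * c j * (if i = j then 2 else 0))"
    by (intro tendsto_sum tendsto_mult_left lim) auto
  moreover have "(\<Sum>i<N. \<Sum>j<N. c i * c j * (t i j ^ (2 * k) + t i j ^ (2 * k + 1))) = 0" for k
    unfolding distrib_left sum.distrib zero by simp
  ultimately have "(\<lambda>k::nat. 0) \<longlonglongrightarrow> (\<Sum>i<N. \<Sum>j<N. c i * c j * (if i = j then 2 else 0))"
    by (simp only:)
  then have "(\<Sum>i<N. \<Sum>j<N. c i * c j * (if i = j then 2 else 0)) = 0"
    unfolding LIMSEQ_const_iff by simp
  moreover have "(\<Sum>i<N. \<Sum>j<N. c i * c j * (if i = j then 2 else 0)) = 2 * (\<Sum>i<N. c i * c i)"
    by (simp add: if_distrib sum_distrib_left mult_ac cong: if_cong)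
  moreover have "(\<Sum>i<N. c i * c i) > 0"
    by (rule sum_pos2[of _ i0]) (use c in \<open>auto simp: zero_less_mult_iff\<close>)
  ultimately show False by simp
qed

section \<open>Divided differences in the squared variable\<close>

text \<open>
  Throughout, \<open>F\<close> is a chain of functions in which \<open>F (Suc j)\<close> is \<open>-(1/w) d/dw\<close> applied to \<open>F j\<close>,
  that is, \<open>-2\<close> times the derivative of \<open>F j\<close> with respect to \<open>w\<^sup>2\<close>. The relation is stated without
  the division so that it also makes sense at \<open>w = 0\<close>.
\<close>

text \<open>
  Up to the factor \<open>(-4)\<^sup>j j!\<close> this is the divided difference of \<open>f\<close>, as a function of the square of
  its argument, at the \<open>j + 1\<close> nodes \<open>(x - j)\<^sup>2, (x - j + 2)\<^sup>2, \<dots>, (x + j)\<^sup>2\<close>: the extreme nodes differ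
  by \<open>4 j x\<close>.
\<close>

fun diffq :: "(real \<Rightarrow> real) \<Rightarrow> nat \<Rightarrow> real \<Rightarrow> real" where
  "diffq f 0 x = f x"
| "diffq f (Suc j) x = (diffq f j (x - 1) - diffq f j (x + 1)) / x"

text \<open>
  The leading coefficient of the interpolation polynomial is the divided difference. The
  polynomial is built by Neville's scheme from those for the first and for the last \<open>j\<close> nodes,
  which belong to the centres \<open>x - 1\<close> and \<open>x + 1\<close>.
\<close>

lemma diffq_interpolation:
  assumes "real j \<le> x"
  shows "\<exists>p :: real poly. degree p \<le> j \<and> coeff p j * ((-4) ^ j * fact j) = diffq f j x \<and>
     (\<forall>i\<le>j. poly p ((x - real j + 2 * real i)\<^sup>2) = f (x - real j + 2 * real i))"
  using assms
proof (induction j arbitrary: x)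
  case 0
  show ?case by (rule exI[of _ "[:f x:]"]) simp
next
  case (Suc j)
  from Suc.IH[of "x - 1"] Suc.prems obtain p where
    p: "degree p \<le> j" "coeff p j * ((-4) ^ j * fact j) = diffq f j (x - 1)"
    "\<And>i. i \<le> j \<Longrightarrow> poly p ((x - 1 - real j + 2 * real i)\<^sup>2) = f (x - 1 - real j + 2 * real i)" by auto
  from Suc.IH[of "x + 1"] Suc.prems obtain q where
    q: "degree q \<le> j" "coeff q j * ((-4) ^ j * fact j) = diffq f j (x + 1)"
    "\<And>i. i \<le> j \<Longrightarrow> poly q ((x + 1 - real j + 2 * real i)\<^sup>2) = f (x + 1 - real j + 2 * real i)" by auto
  have x: "x > 0" using Suc.prems by linarith
  define a b where "a = (x - real (Suc j))\<^sup>2" and "b = (x + real (Suc j))\<^sup>2"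
  have ba: "b - a = 4 * x * real (Suc j)" by (simp add: a_def b_def power2_eq_square algebra_simps)
  then have ba0: "b - a > 0" using x by simp
  define r where "r = smult (1 / (b - a)) ([:-a, 1:] * q - [:-b, 1:] * p)"
  have r: "poly r s = ((s - a) * poly q s - (s - b) * poly p s) / (b - a)" for s
    unfolding r_def by (simp only: poly_smult poly_diff poly_mult poly_pCons poly_0)
      (simp add: algebra_simps diff_divide_distrib add_divide_distrib)
  show ?case
  proof (intro exI[of _ r] conjI allI impI)
    have "degree ([:-a, 1:] * q) \<le> Suc j" "degree ([:-b, 1:] * p) \<le> Suc j"
      using degree_mult_le[of "[:-a, 1:]" q] degree_mult_le[of "[:-b, 1:]" p] p(1) q(1)
      by (simp_all del: mult_pCons_left)
    then show "degree r \<le> Suc j" unfolding r_def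
      by (intro order.trans[OF degree_smult_le] degree_diff_le)
    have "coeff p (Suc j) = 0" "coeff q (Suc j) = 0" using p(1) q(1) by (auto intro: coeff_eq_0)
    then have "coeff r (Suc j) = (coeff q j - coeff p j) / (b - a)"
      by (simp add: r_def)
    then have "coeff r (Suc j) * ((-4) ^ Suc j * fact (Suc j)) =
       (coeff p j * ((-4) ^ j * fact j) - coeff q j * ((-4) ^ j * fact j)) / x"
      (is "?l = (?p - ?q) / x")
    proof -
      have "?l = (coeff q j - coeff p j) / (b - a) * ((-4) ^ Suc j * fact (Suc j))"
        using \<open>coeff r (Suc j) = _\<close> by simp
      also have "\<dots> = (coeff q j - coeff p j) * ((-4) ^ Suc j * fact (Suc j)) / (b - a)"
        by (simp only: times_divide_eq_left)
      also have "(coeff q j - coeff p j) * ((-4) ^ Suc j * fact (Suc j)) =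
          (?p - ?q) * (4 * real (Suc j))"
        by (simp add: algebra_simps)
      also have "(?p - ?q) * (4 * real (Suc j)) / (b - a) = (?p - ?q) / x" unfolding ba using x
          by (simp del: of_nat_Suc)
      finally show ?thesis .
    qed
    also have "\<dots> = diffq f (Suc j) x" unfolding p q by simp
    finally show "coeff r (Suc j) * ((-4) ^ Suc j * fact (Suc j)) = diffq f (Suc j) x" .
  next
    fix i assume i: "i \<le> Suc j"
    let ?y = "x - real (Suc j) + 2 * real i"
    have p': "poly p (?y\<^sup>2) = f ?y" if "i \<le> j" using p(3)[OF that] by (simp add: algebra_simps)
    have q': "poly q (?y\<^sup>2) = f ?y" if "i > 0"
      using q(3)[of "i - 1"] i that by (simp add: algebra_simps of_nat_diff)
    consider "i = 0" | "i = Suc j" | "0 < i" "i \<le> j" using i by linarith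
    then show "poly r (?y\<^sup>2) = f ?y"
    proof cases
      case 1
      then have "?y\<^sup>2 = a" by (simp add: a_def)
      then show ?thesis using p' 1 ba0 unfolding r by (simp add: field_simps)
    next
      case 2
      then have "?y\<^sup>2 = b" by (simp add: b_def algebra_simps)
      then show ?thesis using q' 2 ba0 unfolding r by simp
    next
      case 3
      then show ?thesis using p' q' ba0 unfolding r by (simp add: field_simps)
    qed
  qed
qed

lemma chain_mono:
  fixes F :: "nat \<Rightarrow> real \<Rightarrow> real"
  assumes deriv: "\<And>j w. (F j has_real_derivative - (w * F (Suc j) w)) (at w)"
    and "\<And>w. F (Suc j) w \<ge> 0" "0 \<le> u" "u \<le> v"
  shows "F j v \<le> F j u"
proof (rule DERIV_nonpos_imp_nonincreasing[OF assms(4)])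
  fix w assume "u \<le> w" "w \<le> v"
  then show "\<exists>y. (F j has_real_derivative y) (at w) \<and> y \<le> 0"
    using deriv[of j w] assms by (intro exI[of _ "- (w * F (Suc j) w)"]) simp
qed

text \<open>
  Rolle's theorem in the variable \<open>w\<^sup>2\<close>: passing to the next function of the chain loses one zero.
  Zeros beyond the first are positive, so dividing by \<open>w\<close> is harmless.
\<close>

lemma iterated_Rolle:
  fixes F :: "nat \<Rightarrow> real \<Rightarrow> real"
  assumes deriv: "\<And>j w. (F j has_real_derivative - (w * F (Suc j) w)) (at w)"
    and "a \<ge> 0"
    and z: "\<And>k. k < n \<Longrightarrow> z k < z (Suc k)"
    and z0: "\<And>k. k \<le> n \<Longrightarrow> a \<le> z k \<and> z k \<le> b \<and> F 0 (z k) = 0"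
    and "i \<le> n"
  shows "\<exists>z. (\<forall>k<n - i. z k < z (Suc k)) \<and> (\<forall>k\<le>n - i. a \<le> z k \<and> z k \<le> b \<and> F i (z k) = (0::real))"
  using \<open>i \<le> n\<close>
proof (induction i)
  case 0
  show ?case using z z0 by (intro exI[of _ z]) auto
next
  case (Suc i)
  then obtain z where z: "\<And>k. k < n - i \<Longrightarrow> z k < z (Suc k)"
    and z0: "\<And>k. k \<le> n - i \<Longrightarrow> a \<le> z k \<and> z k \<le> b \<and> F i (z k) = 0" by auto
  have "\<exists>y. z k < y \<and> y < z (Suc k) \<and> F (Suc i) y = 0" if k: "k < n - i" for k
  proof -
    have "F i (z k) = F i (z (Suc k))" using z0[of k] z0[of "Suc k"] k by simp
    moreover have "continuous_on {z k..z (Suc k)} (F i)"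
      by (rule DERIV_continuous_on[where D = "\<lambda>w. - (w * F (Suc i) w)"])
        (rule has_field_derivative_at_within[OF deriv])
    ultimately have "\<exists>y. z k < y \<and> y < z (Suc k) \<and> (F i has_real_derivative 0) (at y)"
      by (rule Rolle[OF z[OF k]]) (use deriv[of i] in \<open>auto simp: real_differentiable_def\<close>)
    then obtain y where y: "z k < y" "y < z (Suc k)" "(F i has_real_derivative 0) (at y)" by blast
    have "y * F (Suc i) y = 0" using DERIV_unique[OF y(3) deriv[of i y]] by simp
    moreover have "y > 0" using y z0[of k] k \<open>a \<ge> 0\<close> by simp
    ultimately show ?thesis using y by auto
  qed
  then obtain y where y: "\<And>k. k < n - i \<Longrightarrow> z k < y k \<and> y k < z (Suc k) \<and> F (Suc i) (y k) = 0"
    by metis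
  show ?case
  proof (intro exI[of _ y] conjI allI impI)
    fix k assume "k < n - Suc i"
    then show "y k < y (Suc k)" using y[of k] y[of "Suc k"] by force
  next
    fix k assume k: "k \<le> n - Suc i"
    then have k': "k < n - i" using Suc.prems by linarith
    have "a \<le> z k" "z (Suc k) \<le> b" using z0[of k] z0[of "Suc k"] k' by auto
    then show "a \<le> y k" "y k \<le> b" "F (Suc i) (y k) = 0" using y[OF k'] by auto
  qed
qed

text \<open>
  The mean value theorem for divided differences, stopped one derivative early. In this form it
  yields both strict positivity, when \<open>F l\<close> is strictly decreasing, and an upper bound.
\<close>

lemma diffq_mean_value:
  fixes F :: "nat \<Rightarrow> real \<Rightarrow> real"
  assumes deriv: "\<And>j w. (F j has_real_derivative - (w * F (Suc j) w)) (at w)"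
    and x: "real (Suc l) \<le> x"
  shows "\<exists>a b. x - real (Suc l) \<le> a \<and> a < b \<and> b \<le> x + real (Suc l) \<and>
    diffq (F 0) (Suc l) x * (b\<^sup>2 - a\<^sup>2) = 4 * 2 ^ l * (F l a - F l b)"
proof -
  obtain p where p: "degree p \<le> Suc l"
    "coeff p (Suc l) * ((-4) ^ Suc l * fact (Suc l)) = diffq (F 0) (Suc l) x"
    "\<And>i. i \<le> Suc l \<Longrightarrow> poly p ((x - real (Suc l) + 2 * real i)\<^sup>2) = F 0 (x - real (Suc l) + 2 * real i)"
    using diffq_interpolation[OF x, of "F 0"] by blast
  \<comment> \<open>The error of interpolation, as a function of \<open>w\<close>, and its images under the same operator.\<close>
  define E where "E i w = F i w - (-2) ^ i * poly ((pderiv ^^ i) p) (w\<^sup>2)" for i w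
  have DE: "(E i has_real_derivative - (w * E (Suc i) w)) (at w)" for i w
    unfolding E_def
    by (rule derivative_eq_intros deriv DERIV_chain2[OF poly_DERIV] refl)+ (simp add: algebra_simps)
  have "\<exists>z. (\<forall>k<Suc l - l. z k < z (Suc k)) \<and>
     (\<forall>k\<le>Suc l - l. x - real (Suc l) \<le> z k \<and> z k \<le> x + real (Suc l) \<and> E l (z k) = 0)"
    by (rule iterated_Rolle[where F = E, OF DE, where z = "\<lambda>k. x - real (Suc l) + 2 * real k"])
      (use x p(3) in \<open>auto simp: E_def algebra_simps\<close>)
  then obtain z where "\<forall>k<Suc l - l. z k < z (Suc k)"
    "\<forall>k\<le>Suc l - l. x - real (Suc l) \<le> z k \<and> z k \<le> x + real (Suc l) \<and> E l (z k) = 0" by blast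
  then have z: "z 0 < z 1" "x - real (Suc l) \<le> z 0" "z 1 \<le> x + real (Suc l)" "E l (z 0) =
      0" "E l (z 1) = 0"
    by simp_all
  define q where "q = (pderiv ^^ l) p"
  have "degree q \<le> 1"
  proof (rule degree_le, intro allI impI)
    fix i :: nat assume "1 < i"
    then have "coeff p (i + l) = 0" using p(1) by (intro coeff_eq_0) simp
    then show "coeff q i = 0" by (simp add: q_def coeff_higher_pderiv)
  qed
  then obtain q0 q1 where q: "q = [:q0, q1:]"
    by (metis degree_eq_zeroE degree1_coeffs le_neq_implies_less less_one pCons_0_0)
  have "q1 = pochhammer 2 l * coeff p (Suc l)"
    using coeff_higher_pderiv[of l p 1] q by (simp add: q_def numeral_2_eq_2)
  moreover have "pochhammer (2::real) l = fact (Suc l)"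
    using pochhammer_fact[of "Suc l", where 'a = real] by (simp add: pochhammer_rec)
  ultimately have "q1 * (-4) ^ Suc l = diffq (F 0) (Suc l) x" using p(2) by (simp add: mult_ac)
  moreover have dF: "F l (z 0) - F l (z 1) = (-2) ^ l * q1 * ((z 0)\<^sup>2 - (z 1)\<^sup>2)"
    using z(4,5) unfolding E_def q_def[symmetric] q by (simp add: algebra_simps)
  moreover have "(-4::real) ^ Suc l = - 4 * 2 ^ l * (-2) ^ l"
    by (simp add: power_mult_distrib[symmetric])
  moreover have "diffq (F 0) (Suc l) x * ((z 1)\<^sup>2 - (z 0)\<^sup>2) =
     q1 * (-4) ^ Suc l * ((z 1)\<^sup>2 - (z 0)\<^sup>2)" using calculation by simp
  ultimately have "diffq (F 0) (Suc l) x * ((z 1)\<^sup>2 - (z 0)\<^sup>2) =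
     q1 * (- 4 * 2 ^ l * (-2) ^ l) * ((z 1)\<^sup>2 - (z 0)\<^sup>2)" by metis
  also have "\<dots> = 4 * 2 ^ l * ((-2) ^ l * q1 * ((z 0)\<^sup>2 - (z 1)\<^sup>2))" by (simp add: algebra_simps)
  also have "(-2) ^ l * q1 * ((z 0)\<^sup>2 - (z 1)\<^sup>2) = F l (z 0) - F l (z 1)" using dF by simp
  finally have "diffq (F 0) (Suc l) x * ((z 1)\<^sup>2 - (z 0)\<^sup>2) = 4 * 2 ^ l * (F l (z 0) - F l (z 1))" .
  with z show ?thesis by blast
qed

lemma diffq_pos:
  fixes F :: "nat \<Rightarrow> real \<Rightarrow> real"
  assumes deriv: "\<And>j w. (F j has_real_derivative - (w * F (Suc j) w)) (at w)"
    and x: "real (Suc l) \<le> x"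
    and nonneg: "\<And>w. F (Suc l) w \<ge> 0"
    and nz: "\<And>a b. 0 \<le> a \<Longrightarrow> a < b \<Longrightarrow> \<exists>w\<in>{a<..<b}. F (Suc l) w \<noteq> 0"
  shows "diffq (F 0) (Suc l) x > 0"
proof -
  obtain a b where ab: "x - real (Suc l) \<le> a" "a < b"
    "diffq (F 0) (Suc l) x * (b\<^sup>2 - a\<^sup>2) = 4 * 2 ^ l * (F l a - F l b)"
    using diffq_mean_value[where F = F, OF deriv x] by blast
  have a: "a \<ge> 0" using ab x by linarith
  have mono: "F l v \<le> F l u" if "a \<le> u" "u \<le> v" for u v
    by (rule chain_mono[where F = F, OF deriv nonneg]) (use that a in auto)
  have "F l b < F l a"
  proof (rule ccontr)
    assume "\<not> F l b < F l a"
    then have const: "F l w = F l a" if "a \<le> w" "w \<le> b" for w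
      using mono[of a w] mono[of w b] that by linarith
    obtain w where w: "a < w" "w < b" "F (Suc l) w \<noteq> 0" using nz[OF a ab(2)] by auto
    have "((\<lambda>_. F l a) has_real_derivative - (w * F (Suc l) w)) (at w)"
      using deriv[of l w] by (rule has_field_derivative_transform_within_open[where S = "{a<..<b}"])
        (use w in \<open>auto intro: const\<close>)
    from DERIV_unique[OF this DERIV_const] have "w * F (Suc l) w = 0" by simp
    with w a show False by simp
  qed
  moreover have "b\<^sup>2 - a\<^sup>2 > 0" using ab(2) a by (simp add: power_strict_mono)
  ultimately show ?thesis using ab(3) zero_less_mult_pos2[of "diffq (F 0) (Suc l) x" "b\<^sup>2 - a\<^sup>2"]
    by simp
qed

lemma diffq_le:
  fixes F :: "nat \<Rightarrow> real \<Rightarrow> real"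
  assumes deriv: "\<And>j w. (F j has_real_derivative - (w * F (Suc j) w)) (at w)"
    and x: "real (Suc l) \<le> x"
    and nonneg: "\<And>w. F (Suc l) w \<ge> 0" "\<And>w. F (Suc (Suc l)) w \<ge> 0"
  shows "\<bar>diffq (F 0) (Suc l) x\<bar> \<le> 2 ^ Suc l * F (Suc l) (x - real (Suc l))"
proof -
  obtain a b where ab: "x - real (Suc l) \<le> a" "a < b"
    "diffq (F 0) (Suc l) x * (b\<^sup>2 - a\<^sup>2) = 4 * 2 ^ l * (F l a - F l b)"
    using diffq_mean_value[where F = F, OF deriv x] by blast
  define y where "y = x - real (Suc l)"
  have a: "a \<ge> y" "y \<ge> 0" using ab x by (auto simp: y_def)
  have ba: "b\<^sup>2 - a\<^sup>2 > 0" using ab(2) a by (simp add: power_strict_mono)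
  have mono: "F j v \<le> F j u" if "\<And>w. F (Suc j) w \<ge> 0" "0 \<le> u" "u \<le> v" for u v j
    by (rule chain_mono[where F = F, OF deriv that])
  \<comment> \<open>Comparison with the parabola in \<open>w\<close> of slope \<open>- F (Suc l) y\<close> in the variable \<open>w\<^sup>2 / 2\<close>.\<close>
  have "F l a + a\<^sup>2 / 2 * F (Suc l) y \<le> F l b + b\<^sup>2 / 2 * F (Suc l) y"
  proof (rule DERIV_nonneg_imp_nondecreasing[of a b "\<lambda>w. F l w + w\<^sup>2 / 2 * F (Suc l) y"])
    fix w assume w: "a \<le> w" "w \<le> b"
    have "((\<lambda>w. F l w + w\<^sup>2 / 2 * c) has_real_derivative w * (c - F (Suc l) w)) (at w)" for c
      by (auto intro!: derivative_eq_intros deriv simp: algebra_simps)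
    from this[of "F (Suc l) y"]
    have "((\<lambda>w. F l w + w\<^sup>2 / 2 * F (Suc l) y) has_real_derivative w *
        (F (Suc l) y - F (Suc l) w)) (at w)" .
    moreover have "F (Suc l) w \<le> F (Suc l) y" using mono[of "Suc l" y w] nonneg w a by simp
    ultimately show "\<exists>d. ((\<lambda>w. F l w + w\<^sup>2 / 2 * F (Suc l) y) has_real_derivative d) (at w) \<and> 0 \<le> d"
      using w a by (intro exI[of _ "w * (F (Suc l) y - F (Suc l) w)"] conjI) auto
  qed (use ab in simp)
  then have "F l a - F l b \<le> (b\<^sup>2 - a\<^sup>2) / 2 * F (Suc l) y"
      by (simp add: algebra_simps diff_divide_distrib)
  then have "4 * 2 ^ l * (F l a - F l b) \<le> 4 * 2 ^ l * ((b\<^sup>2 - a\<^sup>2) / 2 * F (Suc l) y)"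
    by (intro mult_left_mono) auto
  then have "diffq (F 0) (Suc l) x * (b\<^sup>2 - a\<^sup>2) \<le> (2 ^ Suc l * F (Suc l) y) * (b\<^sup>2 - a\<^sup>2)"
    unfolding ab(3) by (simp add: algebra_simps)
  then have "diffq (F 0) (Suc l) x \<le> 2 ^ Suc l * F (Suc l) y"
    by (rule mult_right_le_imp_le[OF _ ba])
  moreover have "0 \<le> diffq (F 0) (Suc l) x * (b\<^sup>2 - a\<^sup>2)"
    unfolding ab(3) using mono[of l a b] nonneg ab a by simp
  then have "0 \<le> diffq (F 0) (Suc l) x" using ba by (metis mult_less_0_iff not_less)
  ultimately show ?thesis by (simp add: y_def)
qed

text \<open>
  About \<open>w/2\<close> terms of the series have their index between \<open>w/2\<close> and \<open>w\<close>. Each of them is at least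
  \<open>f w\<close>, and by Cauchy's criterion their sum is small.
\<close>

lemma decreasing_summable_decay:
  fixes f :: "real \<Rightarrow> real"
  assumes dec: "\<And>u v. 0 \<le> u \<Longrightarrow> u \<le> v \<Longrightarrow> f v \<le> f u" and nonneg: "\<And>w. f w \<ge> 0"
    and sm: "summable (\<lambda>k. f (real k))"
  shows "((\<lambda>w. w * f w) \<longlongrightarrow> 0) at_top"
proof (rule tendstoI)
  fix \<epsilon> :: real assume "\<epsilon> > 0"
  then obtain N where N: "\<And>m n. m \<ge> N \<Longrightarrow> norm (\<Sum>k\<in>{m..<n}. f (real k)) < \<epsilon> / 4"
    using sm[unfolded summable_Cauchy] by (metis zero_less_divide_iff zero_less_numeral)
  show "\<forall>\<^sub>F w in at_top. dist (w * f w) 0 < \<epsilon>"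
    using eventually_ge_at_top[of "max 4 (2 * real N)"]
  proof eventually_elim
    case (elim w)
    define m n where "m = nat \<lfloor>w / 2\<rfloor> + 1" and "n = nat \<lfloor>w\<rfloor> + 1"
    have m: "real m \<le> w / 2 + 1" "real m > w / 2" and n: "real n \<le> w + 1" "real n > w"
      using elim unfolding m_def n_def by linarith+
    have mN: "m \<ge> N" using m elim by linarith
    have mn: "m \<le> n" using m n elim by linarith
    have "(w / 4) * f w \<le> (real n - real m) * f w"
      using m n elim nonneg by (intro mult_right_mono) auto
    also have "\<dots> = (\<Sum>k\<in>{m..<n}. f w)" using mn by (simp add: of_nat_diff)
    also have "\<dots> \<le> (\<Sum>k\<in>{m..<n}. f (real k))"
    proof (intro sum_mono dec)
      fix k assume "k \<in> {m..<n}"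
      then have "k + 1 \<le> n" by simp
      then have "real k + 1 \<le> real n" by linarith
      then show "real k \<le> w" using n by linarith
    qed simp
    also have "\<dots> < \<epsilon> / 4" using N[OF mN, of n] nonneg by (simp add: sum_nonneg)
    finally have "w * f w < \<epsilon>" by simp
    then show ?case using elim nonneg by (simp add: dist_real_def)
  qed
qed

text \<open>
  Decrease of \<open>F (Suc j)\<close> bounds \<open>w\<^sup>2 F (Suc j) w\<close> by the drop of \<open>F j\<close> between \<open>w/2\<close> and \<open>w\<close>, so each
  step along the chain gains a factor \<open>w\<^sup>-\<^sup>2\<close>.
\<close>

lemma chain_decay:
  fixes F :: "nat \<Rightarrow> real \<Rightarrow> real"
  assumes deriv: "\<And>j w. (F j has_real_derivative - (w * F (Suc j) w)) (at w)"
    and nonneg: "\<And>j w. j \<le> L \<Longrightarrow> F j w \<ge> 0" and sm: "summable (\<lambda>k. F 0 (real k))"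
    and "j < L"
  shows "((\<lambda>w. w ^ (2 * j + 1) * F j w) \<longlongrightarrow> 0) at_top"
  using \<open>j < L\<close>
proof (induction j)
  case 0
  have "((\<lambda>w. w * F 0 w) \<longlongrightarrow> 0) at_top"
    using chain_mono[where F = F, OF deriv, of 0] nonneg 0
    by (intro decreasing_summable_decay sm) (auto simp: Suc_leI)
  then show ?case by simp
next
  case (Suc j)
  have mono: "F (Suc j) v \<le> F (Suc j) u" if "0 \<le> u" "u \<le> v" for u v
    using chain_mono[where F = F, OF deriv _ that, of "Suc j"] nonneg Suc.prems by auto
  \<comment> \<open>The constant \<open>4\<close> is a convenient bound for \<open>8/3\<close>, which comes from \<open>w\<^sup>2/2 - (w/2)\<^sup>2/2 = 3 w\<^sup>2/8\<close>.\<close>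
  have key: "w\<^sup>2 * F (Suc j) w \<le> 4 * F j (w / 2)" if w: "w \<ge> 0" for w
  proof -
    define c where "c = F (Suc j) w"
    have "F j w + w\<^sup>2 / 2 * c \<le> F j (w / 2) + (w / 2)\<^sup>2 / 2 * c"
    proof (rule DERIV_nonpos_imp_nonincreasing[of "w / 2" w "\<lambda>v. F j v + v\<^sup>2 / 2 * c"])
      fix v assume v: "w / 2 \<le> v" "v \<le> w"
      have "((\<lambda>v. F j v + v\<^sup>2 / 2 * c) has_real_derivative v * (c - F (Suc j) v)) (at v)"
        by (auto intro!: derivative_eq_intros deriv simp: algebra_simps)
      moreover have "v * (c - F (Suc j) v) \<le> 0"
        using mono[of v w] v w by (intro mult_nonneg_nonpos) (auto simp: c_def)
      ultimately show "\<exists>d. ((\<lambda>v. F j v + v\<^sup>2 / 2 * c) has_real_derivative d) (at v) \<and> d \<le> 0"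
        by blast
    qed (use w in simp)
    moreover have "F j w \<ge> 0" "F j (w / 2) \<ge> 0" "c \<ge> 0" using nonneg Suc.prems by (auto simp: c_def)
    moreover have "w\<^sup>2 * c \<ge> 0" using \<open>c \<ge> 0\<close> by simp
    moreover have "w\<^sup>2 / 2 * c = w\<^sup>2 * c / 2" "(w / 2)\<^sup>2 / 2 * c = w\<^sup>2 * c / 8"
      by (simp_all add: power_divide)
    ultimately show ?thesis unfolding c_def[symmetric] by linarith
  qed
  have lim: "((\<lambda>w. 4 * 2 ^ (2 * j + 1) * ((w / 2) ^ (2 * j + 1) * F j (w / 2))) \<longlongrightarrow> 4 * 2 ^ (2 * j +
      1) * 0) at_top"
  proof (intro tendsto_mult_left)
    have "filterlim (\<lambda>w::real. w / 2) at_top at_top"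
      by (simp add: filterlim_at_top)
    from filterlim_compose[OF Suc.IH this] show "((\<lambda>w. (w / 2) ^ (2 * j + 1) * F j (w / 2)) \<longlongrightarrow> 0) at_top"
      using Suc.prems by simp
  qed
  show ?case
  proof (rule real_tendsto_sandwich[OF _ _ tendsto_const])
    show "\<forall>\<^sub>F w in at_top. 0 \<le> w ^ (2 * Suc j + 1) * F (Suc j) w"
      using eventually_ge_at_top[of 0] by eventually_elim (use nonneg Suc.prems in auto)
    show "\<forall>\<^sub>F w in at_top. w ^ (2 * Suc j + 1) * F (Suc j) w \<le>
       4 * 2 ^ (2 * j + 1) * ((w / 2) ^ (2 * j + 1) * F j (w / 2))"
      using eventually_ge_at_top[of 0]
    proof eventually_elim
      case (elim w)
      have "w ^ (2 * Suc j + 1) * F (Suc j) w = w ^ (2 * j + 1) * (w\<^sup>2 * F (Suc j) w)"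
        by (simp add: power2_eq_square mult_ac)
      also have "\<dots> \<le> w ^ (2 * j + 1) * (4 * F j (w / 2))"
        using elim by (intro mult_left_mono key) auto
      also have "\<dots> = 4 * 2 ^ (2 * j + 1) * ((w / 2) ^ (2 * j + 1) * F j (w / 2))"
        by (simp add: power_divide)
      finally show ?case .
    qed
    show "((\<lambda>w. 4 * 2 ^ (2 * j + 1) * ((w / 2) ^ (2 * j + 1) * F j (w / 2))) \<longlongrightarrow> 0) at_top"
      using lim by simp
  qed
qed

section \<open>Radial positive semidefinite kernels and their marginals\<close>

text \<open>
  Sums range over sets of points, so that families with repeated points or with arbitrary finite
  index sets are covered by \<open>psd_kernel_family\<close>.
\<close>

definition psd_kernel :: "('a \<Rightarrow> 'a \<Rightarrow> real) \<Rightarrow> bool" where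
  "psd_kernel K \<longleftrightarrow> (\<forall>S c. finite S \<longrightarrow> 0 \<le> (\<Sum>x\<in>S. \<Sum>y\<in>S. c x * c y * K x y))"

text \<open>
  Coefficients that belong to the same point are added up.
\<close>

lemma psd_kernel_family:
  assumes "psd_kernel K" and I: "finite I"
  shows "0 \<le> (\<Sum>i\<in>I. \<Sum>j\<in>I. c i * c j * K (x i) (x j))"
proof -
  define C where "C s = (\<Sum>i | i \<in> I \<and> x i = s. c i)" for s
  have merge: "(\<Sum>i\<in>I. c i * G (x i)) = (\<Sum>s\<in>x ` I. C s * G s)" for G :: "'a \<Rightarrow> real"
  proof -
    have "(\<Sum>i\<in>I. c i * G (x i)) = (\<Sum>s\<in>x ` I. \<Sum>i | i \<in> I \<and> x i = s. c i * G (x i))"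
      using I by (rule sum.image_gen)
    also have "\<dots> = (\<Sum>s\<in>x ` I. C s * G s)"
      unfolding C_def sum_distrib_right by (intro sum.cong) auto
    finally show ?thesis .
  qed
  have "(\<Sum>i\<in>I. \<Sum>j\<in>I. c i * c j * K (x i) (x j)) = (\<Sum>i\<in>I. c i * (\<Sum>j\<in>I. c j * K (x i) (x j)))"
    by (simp add: sum_distrib_left mult.assoc)
  also have "\<dots> = (\<Sum>s\<in>x ` I. C s * (\<Sum>t\<in>x ` I. C t * K s t))"
    unfolding merge[of "K _"] by (rule merge)
  also have "\<dots> = (\<Sum>s\<in>x ` I. \<Sum>t\<in>x ` I. C s * C t * K s t)"
    by (simp add: sum_distrib_left mult.assoc)
  also have "\<dots> \<ge> 0" using assms by (simp add: psd_kernel_def)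
  finally show ?thesis .
qed

text \<open>
  Points of the \<open>k\<close>-dimensional space are functions on the natural numbers of which only the first
  \<open>k\<close> values count. This makes the dimension a number, on which one can induct.
\<close>

definition sq_dist :: "nat \<Rightarrow> (nat \<Rightarrow> real) \<Rightarrow> (nat \<Rightarrow> real) \<Rightarrow> real" where
  "sq_dist k x y = (\<Sum>l<k. (x l - y l)\<^sup>2)"

text \<open>
  Profiles are functions of the squared distance, so that adding a coordinate amounts to a
  translation of the argument.
\<close>

definition radial_psd :: "nat \<Rightarrow> (real \<Rightarrow> real) \<Rightarrow> bool" where
  "radial_psd k H \<longleftrightarrow> psd_kernel (\<lambda>x y. H (sq_dist k x y))"

lemma sq_dist_nonneg: "sq_dist k x y \<ge> 0"
  by (simp add: sq_dist_def sum_nonneg)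

lemma sq_dist_extend: "sq_dist (Suc k) (x(k := u)) (y(k := v)) = sq_dist k x y + (u - v)\<^sup>2"
  by (simp add: sq_dist_def)

lemma radial_psd_Suc_imp:
  assumes "radial_psd (Suc k) H"
  shows "radial_psd k H"
  unfolding radial_psd_def psd_kernel_def
proof (intro allI impI)
  fix S :: "(nat \<Rightarrow> real) set" and c :: "(nat \<Rightarrow> real) \<Rightarrow> real" assume "finite S"
  from psd_kernel_family[OF assms[unfolded radial_psd_def] this, of c "\<lambda>x. x(k := 0)"]
  show "0 \<le> (\<Sum>x\<in>S. \<Sum>y\<in>S. c x * c y * H (sq_dist k x y))" by (simp add: sq_dist_extend)
qed

lemma radial_psd_antimono: "radial_psd (k + j) H \<Longrightarrow> radial_psd k H"
  by (induction j) (auto dest: radial_psd_Suc_imp)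

lemma radial_psd_if_isotropic:
  assumes "isotropic_pos_def_on (UNIV :: (real ^ 'n) set) dist g"
  shows "radial_psd CARD('n) (\<lambda>s. g (sqrt s))"
proof -
  have psd: "psd_kernel (\<lambda>x y :: real ^ 'n. g (dist x y))"
    unfolding psd_kernel_def
  proof (intro allI impI)
    fix S :: "(real ^ 'n) set" and c assume S: "finite S"
    define N where "N = card S"
    obtain x where x: "bij_betw x {..<N} S"
      using S ex_bij_betw_nat_finite[of S] by (auto simp: N_def atLeast0LessThan)
    have sum: "(\<Sum>s\<in>S. f s) = (\<Sum>i<N. f (x i))" for f :: "_ \<Rightarrow> real"
      by (rule sum.reindex_bij_betw[OF x, symmetric])
    have "pos_def_matrix N (\<lambda>i j. g (dist (x i) (x j)))"
      using assms x unfolding isotropic_pos_def_on_def by (auto simp: bij_betw_def)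
    then have "(\<exists>i<N. c (x i) \<noteq> 0) \<longrightarrow> (\<Sum>i<N. \<Sum>j<N. c (x i) * g (dist (x i) (x j)) * c (x j)) > 0"
      unfolding pos_def_matrix_def by (rule spec[of _ "\<lambda>i. c (x i)"])
    then have "(\<Sum>i<N. \<Sum>j<N. c (x i) * g (dist (x i) (x j)) * c (x j)) \<ge> 0"
      by (cases "\<exists>i<N. c (x i) \<noteq> 0") auto
    then show "0 \<le> (\<Sum>s\<in>S. \<Sum>t\<in>S. c s * c t * g (dist s t))"
      unfolding sum by (simp add: mult_ac)
  qed
  obtain \<iota> :: "'n \<Rightarrow> nat" where \<iota>: "bij_betw \<iota> UNIV {..<CARD('n)}"
    using ex_bij_betw_finite_nat[of "UNIV :: 'n set"] by (auto simp: atLeast0LessThan)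
  show ?thesis unfolding radial_psd_def psd_kernel_def
  proof (intro allI impI)
    fix S :: "(nat \<Rightarrow> real) set" and c :: "(nat \<Rightarrow> real) \<Rightarrow> real" assume S: "finite S"
    have "dist (\<chi> i. x (\<iota> i) :: real ^ 'n) (\<chi> i. y (\<iota> i)) = sqrt (sq_dist CARD('n) x y)"
        for x y :: "nat \<Rightarrow> real"
      using sum.reindex_bij_betw[OF \<iota>, of "\<lambda>l. (x l - y l)\<^sup>2"]
      by (simp add: dist_vec_def L2_set_def dist_real_def sq_dist_def)
    with psd_kernel_family[OF psd S, of c "\<lambda>x. \<chi> i. x (\<iota> i)"]
    show "0 \<le> (\<Sum>x\<in>S. \<Sum>y\<in>S. c x * c y * g (sqrt (sq_dist CARD('n) x y)))" by simp
  qed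
qed

text \<open>
  Summing over pairs from a long stretch of lattice points counts the sum over all lattice points
  once for each inner point, while the contribution of the points near the ends stays bounded.
\<close>

lemma lattice_sum_nonneg:
  fixes \<psi> :: "real \<Rightarrow> real"
  assumes bnd: "\<And>v. \<bar>\<psi> v\<bar> \<le> B" and e: "e > 0" and m: "real m * e \<ge> R"
    and supp: "\<And>v. \<bar>v\<bar> \<ge> R \<Longrightarrow> \<psi> v = 0"
    and pos: "\<And>n. 0 \<le> (\<Sum>q<n. \<Sum>p<n. \<psi> ((real p - real q) * e))"
  shows "0 \<le> (\<Sum>z<2 * m. \<psi> ((real z - real m) * e))"
proof (rule ccontr)
  define S where "S = (\<Sum>z<2 * m. \<psi> ((real z - real m) * e))"
  assume "\<not> 0 \<le> (\<Sum>z<2 * m. \<psi> ((real z - real m) * e))"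
  then have S: "S < 0" by (simp add: S_def)
  have B: "B \<ge> 0" using bnd[of 0] by linarith
  have far: "\<psi> ((real p - real q) * e) = 0" if "p + m \<le> q \<or> q + m \<le> p" for p q
  proof (rule supp)
    have "real m * e \<le> \<bar>real p - real q\<bar> * e" using that e by (intro mult_right_mono) auto
    from order.trans[OF m this] show "R \<le> \<bar>(real p - real q) * e\<bar>" using e by (simp add: abs_mult)
  qed
  have inner: "(\<Sum>p<n + 2 * m. \<psi> ((real p - real (q + m)) * e)) = S" if "q < n" for n q
  proof -
    have "(\<Sum>p<n + 2 * m. \<psi> ((real p - real (q + m)) * e)) =
        (\<Sum>p\<in>{q..<q + 2 * m}. \<psi> ((real p - real (q + m)) * e))"
      by (rule sum.mono_neutral_right) (use that in \<open>auto intro!: far simp del: of_nat_add\<close>)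
    also have "\<dots> = (\<Sum>z<2 * m. \<psi> ((real (z + q) - real (q + m)) * e))"
      by (rule sum.reindex_bij_witness[of _ "\<lambda>z. z + q" "\<lambda>p. p - q"]) auto
    also have "\<dots> = S" unfolding S_def by (intro sum.cong) (auto simp: algebra_simps)
    finally show ?thesis .
  qed
  have outer: "(\<Sum>p<N. \<psi> ((real p - real q) * e)) \<le> 2 * real m * B" for N q
  proof -
    have "(\<Sum>p<N. \<psi> ((real p - real q) * e)) = (\<Sum>p\<in>{..<N} \<inter> {q - m..<q + m}. \<psi> ((real p - real q) * e))"
      by (rule sum.mono_neutral_right) (auto intro!: far)
    also have "\<dots> \<le> (\<Sum>p\<in>{..<N} \<inter> {q - m..<q + m}. B)"
      by (intro sum_mono) (use bnd in \<open>auto simp: abs_le_iff\<close>)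
    also have "\<dots> = real (card ({..<N} \<inter> {q - m..<q + m})) * B" by simp
    also have "\<dots> \<le> real (2 * m) * B"
    proof (intro mult_right_mono B)
      have "card ({..<N} \<inter> {q - m..<q + m}) \<le> card {q - m..<q + m}" by (intro card_mono) auto
      then show "real (card ({..<N} \<inter> {q - m..<q + m})) \<le> real (2 * m)" by simp
    qed
    finally show ?thesis by simp
  qed
  have "0 \<le> real n * S + 4 * real m * real m * B" for n
  proof -
    let ?T = "\<lambda>q. \<Sum>p<n + 2 * m. \<psi> ((real p - real q) * e)"
    have "{..<n + 2 * m} = {..<m} \<union> {m..<m + n} \<union> {m + n..<n + 2 * m}" by auto
    then have "(\<Sum>q<n + 2 * m. ?T q) = (\<Sum>q\<in>{..<m} \<union> {m..<m + n} \<union> {m + n..<n + 2 * m}. ?T q)"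
      by simp
    also have "\<dots> = (\<Sum>q<m. ?T q) + (\<Sum>q\<in>{m..<m + n}. ?T q) + (\<Sum>q\<in>{m + n..<n + 2 * m}. ?T q)"
      by (subst sum.union_disjoint; (subst sum.union_disjoint)?) auto
    finally have split: "(\<Sum>q<n + 2 * m. ?T q) =
      (\<Sum>q<m. ?T q) + (\<Sum>q\<in>{m..<m + n}. ?T q) + (\<Sum>q\<in>{m + n..<n + 2 * m}. ?T q)" .
    have "(\<Sum>q\<in>{m..<m + n}. ?T q) = (\<Sum>q<n. ?T (q + m))"
      by (rule sum.reindex_bij_witness[of _ "\<lambda>q. q + m" "\<lambda>q. q - m"]) auto
    then have "(\<Sum>q\<in>{m..<m + n}. ?T q) = real n * S" by (simp add: inner del: of_nat_add)
    moreover have "(\<Sum>q<m. ?T q) \<le> (\<Sum>q<m. 2 * real m * B)" by (intro sum_mono outer)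
    moreover have "(\<Sum>q\<in>{m + n..<n + 2 * m}. ?T q) \<le> (\<Sum>q\<in>{m + n..<n + 2 * m}. 2 * real m * B)"
      by (intro sum_mono outer)
    moreover have "0 \<le> (\<Sum>q<n + 2 * m. ?T q)" by (rule pos)
    ultimately show ?thesis unfolding split by simp
  qed
  moreover obtain n :: nat where "real n * (- S) > 4 * real m * real m * B"
    using reals_Archimedean3[of "- S"] S by auto
  ultimately show False by (smt (verit) minus_mult_right)
qed

lemma integral_equal_cells:
  fixes \<psi> :: "real \<Rightarrow> real"
  assumes "continuous_on UNIV \<psi>" "e \<ge> 0"
  shows "integral {a..a + real n * e} \<psi> = (\<Sum>z<n. integral {a + real z * e..a + real (Suc z) * e} \<psi>)"
proof (induction n)
  case (Suc n)
  have "\<psi> integrable_on {a..a + real (Suc n) * e}"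
    using assms by (intro integrable_continuous_real continuous_on_subset[OF assms(1)]) auto
  moreover have "a \<le> a + real n * e" "a + real n * e \<le> a + real (Suc n) * e"
    using assms(2) by (auto intro: mult_right_mono)
  ultimately have "integral {a..a + real n * e} \<psi> + integral {a + real n * e..a + real (Suc n) * e} \<psi> =
      integral {a..a + real (Suc n) * e} \<psi>"
    by (intro Henstock_Kurzweil_Integration.integral_combine) auto
  with Suc show ?case by simp
qed simp

text \<open>
  A Riemann sum argument: the sums in the preceding lemma, multiplied by the mesh, approximate the
  integral.
\<close>

lemma integral_nonneg_of_lattice:
  fixes \<psi> :: "real \<Rightarrow> real"
  assumes cont: "continuous_on UNIV \<psi>" and R: "R > 0"
    and supp: "\<And>v. \<bar>v\<bar> \<ge> R \<Longrightarrow> \<psi> v = 0"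
    and pos: "\<And>n e. 0 < e \<Longrightarrow> 0 \<le> (\<Sum>q<n. \<Sum>p<n. \<psi> ((real p - real q) * e))"
  shows "0 \<le> integral {-R..R} \<psi>"
proof (rule field_le_epsilon)
  fix \<epsilon> :: real assume "\<epsilon> > 0"
  define \<eta> where "\<eta> = \<epsilon> / (2 * R)"
  have \<eta>: "\<eta> > 0" using \<open>\<epsilon> > 0\<close> R by (simp add: \<eta>_def)
  have contI: "continuous_on S \<psi>" for S using cont continuous_on_subset by blast
  have "compact (\<psi> ` {-R..R})" by (intro compact_continuous_image contI) auto
  then obtain B where B: "\<And>v. v \<in> {-R..R} \<Longrightarrow> \<bar>\<psi> v\<bar> \<le> B" and "B > 0"
    using compact_imp_bounded bounded_pos by (metis imageI real_norm_def)
  then have bnd: "\<bar>\<psi> v\<bar> \<le> B" for v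
    using supp[of v] B[of v] \<open>B > 0\<close> by (cases "v \<in> {-R..R}") auto
  have "uniformly_continuous_on {-R..R} \<psi>" by (intro compact_uniformly_continuous contI) auto
  then obtain \<delta> where \<delta>: "\<delta> > 0"
    "\<And>u v. u \<in> {-R..R} \<Longrightarrow> v \<in> {-R..R} \<Longrightarrow> dist v u < \<delta> \<Longrightarrow> dist (\<psi> v) (\<psi> u) < \<eta>"
    using \<eta> unfolding uniformly_continuous_on_def by metis
  obtain m :: nat where m: "real m * \<delta> > R" using reals_Archimedean3[OF \<delta>(1)] by blast
  then have m0: "m > 0" using R by (cases m) auto
  define e where "e = R / real m"
  have e: "e > 0" "real m * e = R" "e < \<delta>" using m m0 R by (auto simp: e_def field_simps)
  have "- \<epsilon> \<le> e * (\<Sum>z<2 * m. \<psi> ((real z - real m) * e)) - \<epsilon>"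
    using lattice_sum_nonneg[where \<psi> = \<psi>, OF bnd e(1), of R m] e supp pos by simp
  also have "\<dots> = (\<Sum>z<2 * m. e * (\<psi> ((real z - real m) * e) - \<eta>))"
    using m0 R by (simp add: sum_distrib_left sum_subtractf right_diff_distrib e_def \<eta>_def)
  also have "\<dots> \<le> (\<Sum>z<2 * m. integral {- R + real z * e..- R + real (Suc z) * e} \<psi>)"
  proof (rule sum_mono)
    fix z assume z: "z \<in> {..<2 * m}"
    let ?a = "- R + real z * e" and ?b = "- R + real (Suc z) * e"
    have "?a = (real z - real m) * e" using e(2) by (simp add: algebra_simps)
    moreover have ab: "?b - ?a = e" "- R \<le> ?a" "?b \<le> R"
    proof -
      have "real (Suc z) * e \<le> real (2 * m) * e" using z e by (intro mult_right_mono) auto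
      then show "?b \<le> R" using e(2) by simp
    qed (use e in \<open>auto simp: algebra_simps\<close>)
    moreover have "integral {?a..?b} (\<lambda>_. \<psi> ?a - \<eta>) \<le> integral {?a..?b} \<psi>"
    proof (rule integral_le)
      fix v assume v: "v \<in> {?a..?b}"
      have v': "?a \<le> v" "v \<le> ?b" using v by simp_all
      have "v \<in> {-R..R}" "?a \<in> {-R..R}"
        using ab(2) order.trans[OF ab(2) v'(1)] order.trans[OF v'(2) ab(3)]
          order.trans[OF order.trans[OF v'] ab(3)] by simp_all
      moreover have "dist v ?a < \<delta>" using v' ab(1) e(3) unfolding dist_real_def by linarith
      ultimately have "dist (\<psi> v) (\<psi> ?a) < \<eta>" by (intro \<delta>)
      then show "\<psi> ?a - \<eta> \<le> \<psi> v" by (simp add: dist_real_def abs_less_iff)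
    qed (auto intro: integrable_continuous_real contI)
    moreover have "integral {?a..?b} (\<lambda>_. \<psi> ?a - \<eta>) = (?b - ?a) * (\<psi> ?a - \<eta>)"
      using ab e by simp
    ultimately show "e * (\<psi> ((real z - real m) * e) - \<eta>) \<le> integral {?a..?b} \<psi>" by metis
  qed
  also have "\<dots> = integral {- R..- R + real (2 * m) * e} \<psi>"
    using integral_equal_cells[OF cont, of e "- R" "2 * m"] e by simp
  also have "- R + real (2 * m) * e = R" using e(2) by simp
  finally show "0 \<le> integral {-R..R} \<psi> + \<epsilon>" by simp
qed

text \<open>
  For a profile \<open>H\<close> that vanishes beyond \<open>R\<^sup>2\<close>, this is the profile obtained by integrating out one
  coordinate.
\<close>

definition marginal :: "real \<Rightarrow> (real \<Rightarrow> real) \<Rightarrow> real \<Rightarrow> real" where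
  "marginal R H s = integral {-R..R} (\<lambda>v. H (s + v\<^sup>2))"

lemma continuous_shift_square:
  fixes H :: "real \<Rightarrow> real"
  assumes "continuous_on {0..} H" "s \<ge> 0"
  shows "continuous_on A (\<lambda>v. H (s + v\<^sup>2))"
  by (rule continuous_on_compose2[OF assms(1)]) (use assms(2) in \<open>auto intro!: continuous_intros\<close>)

text \<open>
  For fixed points and coefficients in dimension \<open>k\<close>, the quadratic form with an additional
  coordinate difference \<open>v\<close> is a function of \<open>v\<close> whose sums over pairs of lattice points are
  values of the quadratic form in dimension \<open>k + 1\<close>.
\<close>

lemma radial_psd_marginal:
  assumes psd: "radial_psd (Suc k) H" and cont: "continuous_on {0..} H" and R: "R > 0"
    and supp: "\<And>s. s \<ge> R\<^sup>2 \<Longrightarrow> H s = 0"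
  shows "radial_psd k (marginal R H)"
  unfolding radial_psd_def psd_kernel_def
proof (intro allI impI)
  fix S :: "(nat \<Rightarrow> real) set" and c :: "(nat \<Rightarrow> real) \<Rightarrow> real" assume S: "finite S"
  note [continuous_intros] = continuous_shift_square[OF cont sq_dist_nonneg]
  define \<psi> where "\<psi> v = (\<Sum>x\<in>S. \<Sum>y\<in>S. c x * c y * H (sq_dist k x y + v\<^sup>2))" for v
  have "0 \<le> integral {-R..R} \<psi>"
  proof (rule integral_nonneg_of_lattice[OF _ R])
    show "continuous_on UNIV \<psi>" unfolding \<psi>_def by (intro continuous_intros)
    show "\<psi> v = 0" if "\<bar>v\<bar> \<ge> R" for v
    proof -
      have "v\<^sup>2 \<ge> R\<^sup>2" using that R by (simp add: abs_le_square_iff[symmetric])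
      then have "H (sq_dist k x y + v\<^sup>2) = 0" for x y
        using sq_dist_nonneg[of k x y] by (intro supp) linarith
      then show ?thesis by (simp add: \<psi>_def)
    qed
    fix n :: nat and e :: real
    have "0 \<le> (\<Sum>i\<in>{..<n} \<times> S. \<Sum>j\<in>{..<n} \<times> S. c (snd i) * c (snd j) *
       H (sq_dist (Suc k) ((snd i)(k := real (fst i) * e)) ((snd j)(k := real (fst j) * e))))"
      using psd_kernel_family[OF psd[unfolded radial_psd_def], of "{..<n} \<times> S" "\<lambda>i. c (snd i)"
         "\<lambda>i. (snd i)(k := real (fst i) * e)"] S by simp
    also have "\<dots> = (\<Sum>p<n. \<Sum>x\<in>S. \<Sum>q<n. \<Sum>y\<in>S. c x * c y *
        H (sq_dist k x y + ((real p - real q) * e)\<^sup>2))"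
      by (simp add: sum.cartesian_product' sq_dist_extend left_diff_distrib)
    also have "\<dots> = (\<Sum>p<n. \<Sum>q<n. \<Sum>x\<in>S. \<Sum>y\<in>S. c x * c y *
        H (sq_dist k x y + ((real p - real q) * e)\<^sup>2))"
      by (intro sum.cong refl sum.swap)
    also have "\<dots> = (\<Sum>q<n. \<Sum>p<n. \<psi> ((real p - real q) * e))"
      unfolding \<psi>_def by (rule sum.swap)
    finally show "0 \<le> (\<Sum>q<n. \<Sum>p<n. \<psi> ((real p - real q) * e))" .
  qed
  also have "integral {-R..R} \<psi> = (\<Sum>x\<in>S. \<Sum>y\<in>S. c x * c y * marginal R H (sq_dist k x y))"
    unfolding \<psi>_def marginal_def
    by (subst integral_sum integral_mult_right[symmetric] |
        (intro S integrable_sum integrable_continuous_real continuous_intros | rule refl sum.cong)+)+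
  finally show "0 \<le> (\<Sum>x\<in>S. \<Sum>y\<in>S. c x * c y * marginal R H (sq_dist k x y))" .
qed

lemma continuous_on_marginal:
  assumes "continuous_on {0..} H"
  shows "continuous_on {0..} (marginal R H)"
proof -
  have "continuous_on ({0..} \<times> cbox (-R) R) (\<lambda>(s, v). H (s + v\<^sup>2))"
    unfolding split_def
    by (rule continuous_on_compose2[OF assms]) (auto intro!: continuous_intros)
  then have "continuous_on {0..} (\<lambda>s. integral (cbox (-R) R) (\<lambda>v. H (s + v\<^sup>2)))"
    by (rule integral_continuous_on_param)
  then show ?thesis by (simp add: marginal_def[abs_def] cbox_interval)
qed

lemma marginal_eq_0:
  assumes "\<And>s. s \<ge> Q \<Longrightarrow> H s = 0" "s \<ge> Q"
  shows "marginal R H s = 0"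
proof -
  have "H (s + v\<^sup>2) = 0" for v using assms(2) by (intro assms(1)) (simp add: add_increasing2)
  then show ?thesis by (simp add: marginal_def)
qed

lemma lborel_integral_compact_support:
  fixes f :: "real \<Rightarrow> real"
  assumes "continuous_on {a..b} f" "\<And>x. x \<notin> {a..b} \<Longrightarrow> f x = 0"
  shows "integrable lborel f" "integral\<^sup>L lborel f = integral {a..b} f"
proof -
  have eq: "(\<lambda>x. indicator {a..b} x *\<^sub>R f x) = f" using assms(2) by (fastforce simp: indicator_def)
  have int: "set_integrable lborel {a..b} f"
    unfolding set_integrable_def by (rule borel_integrable_compact) (use assms in auto)
  then show "integrable lborel f" unfolding set_integrable_def eq .
  show "integral\<^sup>L lborel f = integral {a..b} f"
    using set_borel_integral_eq_integral(2)[OF int] unfolding set_lebesgue_integral_def eq .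
qed

text \<open>
  Discs of radius \<open>r\<close> have area \<open>\<pi> r\<^sup>2\<close>, so the squared norm in the plane is distributed like \<open>\<pi>\<close> times
  Lebesgue measure. The minus sign makes the sets that determine the measure have finite mass.
\<close>

lemma distr_neg_norm_square:
  "distr (lborel :: (real \<times> real) measure) borel (\<lambda>y. - (norm y)\<^sup>2) =
   density lborel (\<lambda>w. ennreal (pi * indicator {..0} w))"
proof (rule measure_eqI_lessThan)
  fix x :: real
  have "(\<lambda>y::real\<times>real. - (norm y)\<^sup>2) -` {x<..} \<inter> space lborel = ball 0 (sqrt (- x))" if "x < 0"
    using that by (auto simp: real_less_rsqrt real_sqrt_less_iff)
      (metis abs_norm_cancel less_minus_iff real_sqrt_abs real_sqrt_less_iff)+
  moreover have "(\<lambda>y::real\<times>real. - (norm y)\<^sup>2) -` {x<..} \<inter> space lborel = {}" if "x \<ge> 0"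
    using that by (auto simp: not_less) (smt (verit) zero_le_power2)
  ultimately have L: "emeasure (distr (lborel :: (real \<times> real) measure) borel (\<lambda>y. - (norm y)\<^sup>2))
      {x<..} =
     (if x < 0 then ennreal (pi * (- x)) else 0)"
    by (auto simp: emeasure_distr emeasure_ball unit_ball_vol_2)
  then show "emeasure (distr (lborel :: (real \<times> real) measure) borel (\<lambda>y. - (norm y)\<^sup>2)) {x<..} < \<infinity>"
    by simp
  have "emeasure (density lborel (\<lambda>w. ennreal (pi * indicator {..0} w))) {x<..} =
     (\<integral>\<^sup>+w. ennreal pi * indicator {x<..0} w \<partial>lborel)"
    by (subst emeasure_density) (auto intro!: nn_integral_cong simp: indicator_def)
  also have "\<dots> = ennreal pi * emeasure lborel {x<..0}" by (rule nn_integral_cmult_indicator) simp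
  also have "\<dots> = (if x < 0 then ennreal (pi * (- x)) else 0)"
    using ennreal_mult[of pi "- x"] by auto
  finally show "emeasure (distr (lborel :: (real \<times> real) measure) borel (\<lambda>y. - (norm y)\<^sup>2)) {x<..} =
    emeasure (density lborel (\<lambda>w. ennreal (pi * indicator {..0} w))) {x<..}" using L by simp
qed auto

text \<open>
  The double marginal at \<open>0\<close> is an integral over the plane whose integrand depends on the squared
  norm only.
\<close>

lemma polar_integral:
  assumes cont: "continuous_on {0..} h" and R: "R > 0" and supp: "\<And>s. s \<ge> R\<^sup>2 \<Longrightarrow> h s = 0"
  shows "marginal R (marginal R h) 0 = pi * integral {0..R\<^sup>2} h"
proof -
  define f where "f w = (if 0 \<le> w then h w else (0::real))" for w
  have out: "R\<^sup>2 \<le> u\<^sup>2" if "u \<notin> {-R..R}" for u :: real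
    using that R by (auto simp: abs_le_square_iff[symmetric])
  have f_meas [measurable]: "f \<in> borel_measurable borel"
  proof -
    have "(\<lambda>w. indicator {0..} w *\<^sub>R h w) \<in> borel_measurable borel"
      using cont by (intro borel_measurable_continuous_on_indicator) auto
    also have "(\<lambda>w. indicator {0..} w *\<^sub>R h w) = f" by (auto simp: f_def indicator_def)
    finally show ?thesis .
  qed
  have int: "integrable (lborel \<Otimes>\<^sub>M lborel) (\<lambda>y::real\<times>real. f ((norm y)\<^sup>2))"
  proof -
    have "integrable lborel (\<lambda>y::real\<times>real. indicator (cball 0 R) y *\<^sub>R h ((norm y)\<^sup>2))"
      by (intro borel_integrable_compact continuous_on_compose2[OF cont])
          (auto intro!: continuous_intros)
    also have "(\<lambda>y::real\<times>real. indicator (cball 0 R) y *\<^sub>R h ((norm y)\<^sup>2)) = (\<lambda>y. f ((norm y)\<^sup>2))"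
    proof
      fix y :: "real \<times> real"
      have "h ((norm y)\<^sup>2) = 0" if "y \<notin> cball 0 R"
        using that R by (intro supp power_mono) auto
      then show "indicator (cball 0 R) y *\<^sub>R h ((norm y)\<^sup>2) = f ((norm y)\<^sup>2)"
        by (auto simp: f_def indicator_def)
    qed
    finally show ?thesis by (simp only: lborel_prod)
  qed
  have "pi * integral {0..R\<^sup>2} h = pi * integral\<^sup>L lborel f"
  proof -
    have "continuous_on {0..R\<^sup>2} f \<longleftrightarrow> continuous_on {0..R\<^sup>2} h"
      by (intro continuous_on_cong) (auto simp: f_def)
    moreover have "continuous_on {0..R\<^sup>2} h" by (rule continuous_on_subset[OF cont]) auto
    ultimately have "integral\<^sup>L lborel f = integral {0..R\<^sup>2} f"
      by (intro lborel_integral_compact_support(2)) (auto simp: f_def supp)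
    also have "\<dots> = integral {0..R\<^sup>2} h" by (intro integral_cong) (auto simp: f_def)
    finally show ?thesis by simp
  qed
  also have "\<dots> = pi * (LINT w|lborel. f (- w))"
    using lborel_integral_real_affine[of "-1" f 0] by simp
  also have "\<dots> = (LINT w|lborel. (pi * indicator {..0} w) *\<^sub>R f (- w))"
    unfolding Bochner_Integration.integral_mult_right_zero[symmetric]
    by (intro Bochner_Integration.integral_cong) (auto simp: f_def indicator_def)
  also have "\<dots> = (LINT w|density lborel (\<lambda>w. ennreal (pi * indicator {..0} w)). f (- w))"
    by (subst integral_density) auto
  also have "\<dots> = (LINT y|lborel. f ((norm (y :: real \<times> real))\<^sup>2))"
    unfolding distr_neg_norm_square[symmetric] by (subst integral_distr) auto
  also have "\<dots> = (LINT u|lborel. LINT v|lborel. f ((norm (u :: real, v :: real))\<^sup>2))"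
    using lborel_pair.integral_fst'[OF int, symmetric] by (simp only: lborel_prod)
  also have "\<dots> = (LINT u|lborel. marginal R h (u\<^sup>2))"
  proof (intro Bochner_Integration.integral_cong refl)
    fix u :: real
    have "(LINT v|lborel. f ((norm (u, v :: real))\<^sup>2)) = (LINT v|lborel. h (u\<^sup>2 + v\<^sup>2))"
      by (simp add: norm_Pair f_def)
    also have "\<dots> = marginal R h (u\<^sup>2)"
      unfolding marginal_def
    proof (rule lborel_integral_compact_support(2))
      show "continuous_on {- R..R} (\<lambda>v. h (u\<^sup>2 + v\<^sup>2))" by (rule continuous_shift_square[OF cont]) simp
      show "h (u\<^sup>2 + v\<^sup>2) = 0" if "v \<notin> {- R..R}" for v
        using out[OF that] by (intro supp) (simp add: add_increasing)
    qed
    finally show "(LINT v|lborel. f ((norm (u, v :: real))\<^sup>2)) = marginal R h (u\<^sup>2)" .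
  qed
  also have "\<dots> = integral {-R..R} (\<lambda>u. marginal R h (0 + u\<^sup>2))"
    unfolding add_0
  proof (rule lborel_integral_compact_support(2))
    show "continuous_on {- R..R} (\<lambda>v. marginal R h (v\<^sup>2))"
      using continuous_shift_square[OF continuous_on_marginal[OF cont], of 0] by simp
    show "marginal R h (v\<^sup>2) = 0" if "v \<notin> {- R..R}" for v
      using out[OF that] supp by (intro marginal_eq_0) auto
  qed
  finally show ?thesis by (simp add: marginal_def)
qed

lemma marginal_marginal:
  assumes cont: "continuous_on {0..} h" and R: "R > 0" and supp: "\<And>s. s \<ge> R\<^sup>2 \<Longrightarrow> h s = 0"
    and s: "s \<ge> 0"
  shows "marginal R (marginal R h) s = pi * integral {s..R\<^sup>2} h"
proof -
  have "continuous_on {0..} (\<lambda>w. h (s + w))"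
    by (rule continuous_on_compose2[OF cont]) (use s in \<open>auto intro!: continuous_intros\<close>)
  moreover have "h (s + w) = 0" if "w \<ge> R\<^sup>2" for w using that s by (intro supp) simp
  ultimately have "marginal R (marginal R (\<lambda>w. h (s + w))) 0 = pi * integral {0..R\<^sup>2} (\<lambda>w. h (s + w))"
    using R by (intro polar_integral) auto
  moreover have "marginal R (marginal R (\<lambda>w. h (s + w))) 0 = marginal R (marginal R h) s"
    by (simp add: marginal_def add.assoc)
  moreover have "integral {0..R\<^sup>2} (\<lambda>w. h (s + w)) = integral {s..R\<^sup>2} h"
  proof -
    have c: "continuous_on {a..b} h" if "a \<ge> 0" for a b
      by (rule continuous_on_subset[OF cont]) (use that in auto)
    have "integral {0..R\<^sup>2} (\<lambda>w. h (s + w)) = integral {s..s + R\<^sup>2} h"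
      using integral_shift_Icc_real[of 0 "R\<^sup>2" h s] by (simp add: add.commute o_def)
    also have "\<dots> = integral {s..R\<^sup>2} h"
    proof (cases "s \<le> R\<^sup>2")
      case True
      have "integral {s..R\<^sup>2} h + integral {R\<^sup>2..s + R\<^sup>2} h = integral {s..s + R\<^sup>2} h"
        using True s by (intro Henstock_Kurzweil_Integration.integral_combine
            integrable_continuous_real c) auto
      moreover have "integral {R\<^sup>2..s + R\<^sup>2} h = integral {R\<^sup>2..s + R\<^sup>2} (\<lambda>_. 0)"
        by (intro integral_cong) (auto simp: supp)
      ultimately show ?thesis by simp
    next
      case False
      have "integral {s..s + R\<^sup>2} h = integral {s..s + R\<^sup>2} (\<lambda>_. 0)"
        using False by (intro integral_cong) (auto simp: supp)
      with False show ?thesis by simp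
    qed
    finally show ?thesis .
  qed
  ultimately show ?thesis by simp
qed

section \<open>Cosine integrals and cosine series\<close>

text \<open>
  Polynomials in \<open>u\<close> are dense in the continuous functions, by the Stone-Weierstrass theorem, so
  \<open>h\<close> is orthogonal to itself. The cases of interest are \<open>u t = t\<^sup>2\<close> and \<open>u = cos\<close>.
\<close>

lemma moments_determine:
  fixes h u :: "real \<Rightarrow> real"
  assumes ab: "a < b" and h: "continuous_on {a..b} h" and u: "continuous_on {a..b} u"
    and inj: "inj_on u {a..b}"
    and mom: "\<And>k. integral {a..b} (\<lambda>x. h x * u x ^ k) = 0"
    and x: "x \<in> {a..b}"
  shows "h x = 0"
proof -
  have cp: "continuous_on {a..b} (\<lambda>x. poly p (u x))" for p
    by (intro continuous_intros u)
  have poly0: "integral {a..b} (\<lambda>x. h x * poly p (u x)) = 0" for p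
  proof -
    have "integral {a..b} (\<lambda>x. h x * poly p (u x)) =
        integral {a..b} (\<lambda>x. \<Sum>i\<le>degree p. coeff p i * (h x * u x ^ i))"
      by (simp add: poly_altdef sum_distrib_left mult_ac)
    also have "\<dots> = (\<Sum>i\<le>degree p. integral {a..b} (\<lambda>x. coeff p i * (h x * u x ^ i)))"
      by (intro integral_sum integrable_continuous_real continuous_intros h u) auto
    finally show ?thesis by (simp add: mom)
  qed
  let ?I = "integral {a..b} (\<lambda>x. \<bar>h x\<bar>)"
  have "integral {a..b} (\<lambda>x. h x * h x) \<le> 0"
  proof (rule field_le_epsilon)
    fix \<epsilon> :: real assume \<epsilon>: "\<epsilon> > 0"
    have I: "?I \<ge> 0" by (intro integral_nonneg integrable_continuous_real continuous_intros h) auto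
    define e where "e = \<epsilon> / (?I + 1)"
    have e: "e > 0" using \<epsilon> I by (simp add: e_def)
    have "\<exists>g. (\<exists>p. g = (\<lambda>x. poly p (u x))) \<and> (\<forall>x\<in>{a..b}. \<bar>h x - g x\<bar> < e)"
    proof (rule Stone_Weierstrass_HOL[of "{a..b}" "\<lambda>g. \<exists>p. g = (\<lambda>x. poly p (u x))"])
      show "\<exists>p. (\<lambda>x. c) = (\<lambda>x. poly p (u x))" for c by (rule exI[of _ "[:c:]"]) simp
      show "\<exists>p. (\<lambda>x. f x + g x) = (\<lambda>x. poly p (u x))"
        if "(\<exists>p. f = (\<lambda>x. poly p (u x))) \<and> (\<exists>p. g = (\<lambda>x. poly p (u x)))" for f g
        using that poly_add by metis
      show "\<exists>p. (\<lambda>x. f x * g x) = (\<lambda>x. poly p (u x))"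
        if "(\<exists>p. f = (\<lambda>x. poly p (u x))) \<and> (\<exists>p. g = (\<lambda>x. poly p (u x)))" for f g
        using that poly_mult by metis
      show "\<exists>f. (\<exists>p. f = (\<lambda>x. poly p (u x))) \<and> f x \<noteq> f y"
        if "x \<in> {a..b} \<and> y \<in> {a..b} \<and> x \<noteq> y" for x y
        using that inj
        by (intro exI[of _ u] conjI exI[of _ "[:0, 1:]"]) (auto dest: inj_onD)
      show "continuous_on {a..b} f" if "\<exists>p. f = (\<lambda>x. poly p (u x))" for f
        using that cp by blast
    qed (fact compact_Icc h e)+
    then obtain p where p: "\<And>x. x \<in> {a..b} \<Longrightarrow> \<bar>h x - poly p (u x)\<bar> < e" by blast
    have "integral {a..b} (\<lambda>x. h x * h x) =
        integral {a..b} (\<lambda>x. h x * h x) - integral {a..b} (\<lambda>x. h x * poly p (u x))"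
      by (simp add: poly0)
    also have "\<dots> = integral {a..b} (\<lambda>x. h x * (h x - poly p (u x)))"
      by (subst Henstock_Kurzweil_Integration.integral_diff[symmetric])
        (auto intro!: integrable_continuous_real continuous_intros h cp simp: right_diff_distrib)
    also have "\<dots> \<le> integral {a..b} (\<lambda>x. e * \<bar>h x\<bar>)"
    proof (intro integral_le integrable_continuous_real continuous_intros h u)
      fix x assume "x \<in> {a..b}"
      have "h x * (h x - poly p (u x)) \<le> \<bar>h x\<bar> * \<bar>h x - poly p (u x)\<bar>"
        by (metis abs_ge_self abs_mult)
      also have "\<dots> \<le> \<bar>h x\<bar> * e" using p[OF \<open>x \<in> {a..b}\<close>] by (intro mult_left_mono) auto
      finally show "h x * (h x - poly p (u x)) \<le> e * \<bar>h x\<bar>" by (simp add: mult.commute)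
    qed
    also have "\<dots> = e * ?I" by simp
    also have "\<dots> \<le> \<epsilon>" using \<epsilon> I by (simp add: e_def field_simps)
    finally show "integral {a..b} (\<lambda>x. h x * h x) \<le> 0 + \<epsilon>" by simp
  qed
  moreover have "integral {a..b} (\<lambda>x. h x * h x) \<ge> 0"
    by (intro integral_nonneg integrable_continuous_real continuous_intros h) auto
  ultimately have "integral {a..b} (\<lambda>x. h x * h x) = 0" by simp
  moreover have "continuous_on {a..b} (\<lambda>x. h x * h x)" by (intro continuous_intros h)
  ultimately have "\<forall>x\<in>{a..b}. h x * h x = 0"
    using integral_eq_0_iff[OF _ ab, of "\<lambda>x. h x * h x"] by simp
  with x show ?thesis by auto
qed

lemma DERIV_integral_cos:
  assumes K: "continuous_on {0..R} K"
  shows "((\<lambda>w. integral {0..R} (\<lambda>t. cos (w * t) * K t)) has_real_derivative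
     - integral {0..R} (\<lambda>t. sin (w * t) * (t * K t))) (at w)"
proof -
  have "((\<lambda>w. integral (cbox 0 R) (\<lambda>t. cos (w * t) * K t)) has_real_derivative
     integral (cbox 0 R) (\<lambda>t. - (sin (w * t) * (t * K t)))) (at w within UNIV)"
  proof (rule leibniz_rule_field_derivative)
    show "((\<lambda>w. cos (w * t) * K t) has_real_derivative - (sin (w * t) * (t * K t)))
        (at w within UNIV)" for w t
      by (auto intro!: derivative_eq_intros)
    show "(\<lambda>t. cos (w * t) * K t) integrable_on cbox 0 R" for w
      unfolding cbox_interval by (intro integrable_continuous_real continuous_intros K)
    show "continuous_on (UNIV \<times> cbox 0 R) (\<lambda>(w, t). - (sin (w * t) * (t * K t)))"
      unfolding cbox_interval split_def
      by (intro continuous_intros continuous_on_compose2[OF K]) auto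
  qed auto
  then show ?thesis by (simp add: cbox_interval)
qed

lemma DERIV_integral_sin:
  assumes K: "continuous_on {0..R} K"
  shows "((\<lambda>w. integral {0..R} (\<lambda>t. sin (w * t) * K t)) has_real_derivative
     integral {0..R} (\<lambda>t. cos (w * t) * (t * K t))) (at w)"
proof -
  have "((\<lambda>w. integral (cbox 0 R) (\<lambda>t. sin (w * t) * K t)) has_real_derivative
     integral (cbox 0 R) (\<lambda>t. cos (w * t) * (t * K t))) (at w within UNIV)"
  proof (rule leibniz_rule_field_derivative)
    show "((\<lambda>w. sin (w * t) * K t) has_real_derivative cos (w * t) * (t * K t))
        (at w within UNIV)" for w t
      by (auto intro!: derivative_eq_intros)
    show "(\<lambda>t. sin (w * t) * K t) integrable_on cbox 0 R" for w
      unfolding cbox_interval by (intro integrable_continuous_real continuous_intros K)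
    show "continuous_on (UNIV \<times> cbox 0 R) (\<lambda>(w, t). cos (w * t) * (t * K t))"
      unfolding cbox_interval split_def
      by (intro continuous_intros continuous_on_compose2[OF K]) auto
  qed auto
  then show ?thesis by (simp add: cbox_interval)
qed

lemma DERIV_locally_zero:
  fixes f :: "real \<Rightarrow> real"
  assumes "(f has_real_derivative D) (at w)" "w \<in> {a<..<b}" "\<And>v. v \<in> {a<..<b} \<Longrightarrow> f v = 0"
  shows "D = 0"
proof -
  have "((\<lambda>_. 0) has_real_derivative D) (at w)"
    by (rule has_field_derivative_transform_within_open[OF assms(1), of "{a<..<b}"]) (use assms in auto)
  then show ?thesis using DERIV_unique DERIV_const by blast
qed

text \<open>
  If the transform vanishes on an interval, then so do all its derivatives; up to sign
  these are the moments of \<open>cos (w t) * K t\<close> for even and of \<open>sin (w t) * K t\<close> for odd powers of \<open>t\<close>.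
\<close>

lemma cos_transform_locally_zero:
  fixes K :: "real \<Rightarrow> real" and a b R t :: real
  assumes R: "R > 0" and K: "continuous_on {0..R} K" and ab: "a < b"
    and zero: "\<And>w. w \<in> {a<..<b} \<Longrightarrow> integral {0..R} (\<lambda>t. cos (w * t) * K t) = 0"
    and t: "t \<in> {0..R}"
  shows "K t = 0"
proof -
  have "(\<forall>w\<in>{a<..<b}. integral {0..R} (\<lambda>t. cos (w * t) * (t ^ (2 * k) * K t)) = 0) \<and>
        (\<forall>w\<in>{a<..<b}. integral {0..R} (\<lambda>t. sin (w * t) * (t * (t ^ (2 * k) * K t))) = 0)" for k
  proof (induction k)
    case 0
    have "integral {0..R} (\<lambda>t. sin (w * t) * (t * K t)) = 0" if "w \<in> {a<..<b}" for w
      using DERIV_locally_zero[OF DERIV_integral_cos[OF K] that zero] by simp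
    with zero show ?case by simp
  next
    case (Suc k)
    have c: "continuous_on {0..R} (\<lambda>t. t * (t ^ (2 * k) * K t))" "continuous_on {0..R}
        (\<lambda>t. t ^ (2 * Suc k) * K t)"
      by (intro continuous_intros K)+
    have 1: "integral {0..R} (\<lambda>t. cos (w * t) * (t ^ (2 * Suc k) * K t)) = 0" if "w \<in> {a<..<b}" for w
      using DERIV_locally_zero[OF DERIV_integral_sin[OF c(1)] that] Suc by (simp add: mult_ac)
    have "integral {0..R} (\<lambda>t. sin (w * t) * (t * (t ^ (2 * Suc k) * K t))) = 0" if "w \<in> {a<..<b}" for w
      using DERIV_locally_zero[OF DERIV_integral_cos[OF c(2)] that 1] by simp
    with 1 show ?case by simp
  qed
  note mom = this
  define w where "w = (a + b) / 2"
  have w: "w \<in> {a<..<b}" using ab by (simp add: w_def)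
  have inj: "inj_on (\<lambda>t. t\<^sup>2) {0..R}" by (auto intro!: inj_onI)
  have pw: "(t\<^sup>2) ^ k = t ^ (2 * k)" for t :: real and k by (rule power_mult[symmetric])
  have "cos (w * t) * K t = 0"
  proof (rule moments_determine[OF R _ _ inj _ t])
    have "integral {0..R} (\<lambda>t. cos (w * t) * K t * (t\<^sup>2) ^ k) =
        integral {0..R} (\<lambda>t. cos (w * t) * (t ^ (2 * k) * K t))" for k
      by (simp only: pw mult_ac)
    then show "integral {0..R} (\<lambda>t. cos (w * t) * K t * (t\<^sup>2) ^ k) = 0" for k
      using mom[of k] w by (simp only:)
  qed (intro continuous_intros K)+
  moreover have "sin (w * t) * (t * K t) = 0"
  proof (rule moments_determine[OF R _ _ inj _ t])
    have "integral {0..R} (\<lambda>t. sin (w * t) * (t * K t) * (t\<^sup>2) ^ k) =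
        integral {0..R} (\<lambda>t. sin (w * t) * (t * (t ^ (2 * k) * K t)))" for k
      by (simp only: pw mult_ac)
    then show "integral {0..R} (\<lambda>t. sin (w * t) * (t * K t) * (t\<^sup>2) ^ k) = 0" for k
      using mom[of k] w by (simp only:)
  qed (intro continuous_intros K)+
  moreover have "cos (w * t) \<noteq> 0 \<or> (sin (w * t) \<noteq> 0 \<and> t \<noteq> 0)"
    using sin_zero_abs_cos_one[of "w * t"] by (cases "t = 0") auto
  ultimately show ?thesis by auto
qed

lemma integral_cos_int: "integral {0..pi} (\<lambda>t. cos (of_int n * t)) = (if n = 0 then pi else 0)"
proof (cases "n = 0")
  case False
  have "((\<lambda>t. cos (of_int n * t)) has_integral
     (sin (of_int n * pi) / of_int n - sin (of_int n * 0) / of_int n)) {0..pi}"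
    by (rule fundamental_theorem_of_calculus)
      (use False in \<open>auto intro!: derivative_eq_intros simp:
          has_real_derivative_iff_has_vector_derivative[symmetric]\<close>)
  then show ?thesis using False sin_npi_int[of n] by (auto dest!: integral_unique simp: mult.commute)
qed simp

lemma integral_cos_cos:
  "integral {0..pi} (\<lambda>t. cos (real k * t) * cos (real m * t)) =
     (if k = m then if k = 0 then pi else pi / 2 else 0)"
proof -
  have "cos (real k * t) * cos (real m * t) =
     cos (of_int (int k - int m) * t) / 2 + cos (of_int (int k + int m) * t) / 2" for t
    by (simp add: cos_times_cos algebra_simps add_divide_distrib)
  then have "integral {0..pi} (\<lambda>t. cos (real k * t) * cos (real m * t)) =
     integral {0..pi} (\<lambda>t. cos (of_int (int k - int m) * t)) / 2 +
     integral {0..pi} (\<lambda>t. cos (of_int (int k + int m) * t)) / 2"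
    by (simp only:) (subst Henstock_Kurzweil_Integration.integral_add,
        auto intro!: integrable_continuous_real continuous_intros)
  then show ?thesis unfolding integral_cos_int by auto
qed

text \<open>
  Fejer's argument: integrating \<open>G\<close> against the kernel \<open>(\<Sum>i, j. cos ((i - j) t))\<close>, which is nonnegative
  and has integral \<open>N \<pi>\<close>, bounds the Cesaro means of the coefficients by the maximum of \<open>G\<close>. For
  nonnegative coefficients this bounds the partial sums.
\<close>

lemma cos_coeffs_summable:
  fixes G :: "real \<Rightarrow> real"
  assumes G: "continuous_on {0..pi} G"
    and nonneg: "\<And>k. integral {0..pi} (\<lambda>t. cos (real k * t) * G t) \<ge> 0"
  shows "summable (\<lambda>k. integral {0..pi} (\<lambda>t. cos (real k * t) * G t))"
proof -
  define F where "F w = integral {0..pi} (\<lambda>t. cos (w * t) * G t)" for w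
  have "compact (G ` {0..pi})" by (intro compact_continuous_image G) auto
  then obtain B where B: "\<And>t. t \<in> {0..pi} \<Longrightarrow> \<bar>G t\<bar> \<le> B"
    using compact_imp_bounded bounded_pos by (metis imageI real_norm_def)
  have even: "F (- w) = F w" for w by (simp add: F_def)
  have Fk: "F (real k) \<ge> 0" for k using nonneg by (simp add: F_def)
  have Fij: "F (real i - real j) \<ge> 0" for i j
  proof (cases "i \<le> j")
    case True
    then show ?thesis using Fk[of "j - i"] even[of "real i - real j"] by (simp add: of_nat_diff)
  next
    case False
    then show ?thesis using Fk[of "i - j"] by (simp add: of_nat_diff)
  qed
  have upper: "(\<Sum>i<N. \<Sum>j<N. F (real i - real j)) \<le> B * (real N * pi)" for N
  proof -
    \<comment> \<open>\<open>D t\<close> is the squared modulus of \<open>\<Sum>k<N. exp (i k t)\<close>.\<close>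
    define D where "D t = (\<Sum>i<N. \<Sum>j<N. cos ((real i - real j) * t))" for t
    have D: "D t \<ge> 0" for t
    proof -
      have "D t = (\<Sum>i<N. cos (real i * t)) * (\<Sum>j<N. cos (real j * t)) +
          (\<Sum>i<N. sin (real i * t)) * (\<Sum>j<N. sin (real j * t))"
        unfolding D_def sum_product by (simp add: left_diff_distrib cos_diff sum.distrib)
      then show ?thesis by simp
    qed
    have cD: "continuous_on {0..pi} D" unfolding D_def by (intro continuous_intros)
    have "(\<Sum>i<N. \<Sum>j<N. F (real i - real j)) = integral {0..pi} (\<lambda>t. D t * G t)"
      unfolding F_def D_def sum_distrib_right
      by (simp add: integral_sum integrable_sum integrable_continuous_real continuous_intros G)
    also have "\<dots> \<le> integral {0..pi} (\<lambda>t. D t * B)"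
      by (intro integral_le integrable_continuous_real continuous_intros cD G mult_left_mono D)
        (use B in \<open>auto simp: abs_le_iff\<close>)
    also have "\<dots> = B * integral {0..pi} D" by simp
    also have "integral {0..pi} D =
        (\<Sum>i<N. \<Sum>j<N. integral {0..pi} (\<lambda>t. cos (of_int (int i - int j) * t)))"
      unfolding D_def
      by (simp add: integral_sum integrable_sum integrable_continuous_real continuous_intros)
    also have "\<dots> = real N * pi" by (simp only: integral_cos_int) simp
    finally show ?thesis .
  qed
  show ?thesis unfolding F_def[symmetric]
  proof (rule summableI_nonneg_bounded[OF Fk])
    fix N
    show "(\<Sum>k<N. F (real k)) \<le> 2 * B * pi"
    proof (cases "N = 0")
      case True
      have "B \<ge> 0" using B[of 0] by simp
      with True show ?thesis by simp
    next
      case False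
      have "real N * (\<Sum>k<N. F (real k)) = (\<Sum>i<N. \<Sum>k<N. F (real k))" by simp
      also have "\<dots> = (\<Sum>i<N. \<Sum>j\<in>{i..<i + N}. F (real i - real j))"
      proof (rule sum.cong[OF refl])
        fix i
        show "(\<Sum>k<N. F (real k)) = (\<Sum>j\<in>{i..<i + N}. F (real i - real j))"
          by (rule sum.reindex_bij_witness[of _ "\<lambda>j. j - i" "\<lambda>k. k + i"]) (auto simp: even)
      qed
      also have "\<dots> \<le> (\<Sum>i<N. \<Sum>j<2 * N. F (real i - real j))"
        by (intro sum_mono sum_mono2) (auto intro: Fij)
      also have "\<dots> \<le> (\<Sum>i<2 * N. \<Sum>j<2 * N. F (real i - real j))"
        by (intro sum_mono2 sum_nonneg) (auto intro: Fij)
      also have "\<dots> \<le> real N * (2 * B * pi)" using upper[of "2 * N"] by (simp add: mult_ac)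
      finally show ?thesis using False by simp
    qed
  qed
qed

text \<open>
  The series converges uniformly, and its sum has the same cosine coefficients as \<open>\<pi> G\<close>. The
  difference is then orthogonal to all powers of \<open>cos\<close>, hence zero.
\<close>

lemma cos_series_inversion:
  fixes G :: "real \<Rightarrow> real"
  assumes G: "continuous_on {0..pi} G"
    and summ: "summable (\<lambda>k. \<bar>integral {0..pi} (\<lambda>t. cos (real k * t) * G t)\<bar>)"
    and x: "x \<in> {0..pi}"
  shows "(\<lambda>k. integral {0..pi} (\<lambda>t. cos (real k * t) * G t) *
      (if k = 0 then 1 else 2 * cos (real k * x))) sums (pi * G x)"
proof -
  define f where "f k = integral {0..pi} (\<lambda>t. cos (real k * t) * G t)" for k
  define u where "u k y = f k * (if k = 0 then 1 else 2 * cos (real k * y))" for k and y :: real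
  define s where "s y = (\<Sum>k. u k y)" for y
  have bnd: "\<bar>u k y\<bar> \<le> 2 * \<bar>f k\<bar>" for k y
    by (auto simp: u_def abs_mult intro!: mult_left_mono
        order.trans[OF mult_left_mono[OF abs_cos_le_one]])
  have sm: "summable (\<lambda>k. 2 * \<bar>f k\<bar>)" using summ by (simp add: f_def)
  have unif: "uniform_limit {0..pi} (\<lambda>n y. \<Sum>k<n. u k y) s sequentially"
    unfolding s_def by (rule Weierstrass_m_test[OF _ sm]) (use bnd in auto)
  have cu: "continuous_on {0..pi} (u k)" for k unfolding u_def
      by (cases "k = 0") (auto intro!: continuous_intros)
  have cs: "continuous_on {0..pi} s"
    by (rule uniform_limit_theorem[OF _ unif]) (auto intro!: always_eventually continuous_intros cu)
  have coeff: "integral {0..pi} (\<lambda>y. s y * cos (real m * y)) = pi * f m" for m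
  proof -
    have "uniform_limit {0..pi} (\<lambda>n y. (\<Sum>k<n. u k y) * cos (real m * y))
        (\<lambda>y. s y * cos (real m * y)) sequentially"
    proof (rule uniform_lim_mult[OF unif uniform_limit_const])
      show "bounded (s ` {0..pi})" by (intro compact_imp_bounded compact_continuous_image cs) auto
      show "bounded ((\<lambda>y. cos (real m * y)) ` {0..pi})"
        by (intro compact_imp_bounded compact_continuous_image continuous_intros) auto
    qed
    then obtain I J where I: "\<And>n. ((\<lambda>y. (\<Sum>k<n. u k y) * cos (real m * y)) has_integral I n) {0..pi}"
      and J: "((\<lambda>y. s y * cos (real m * y)) has_integral J) {0..pi}" and lim: "I \<longlonglongrightarrow> J"
      by (rule uniform_limit_integral) (auto intro!: continuous_intros cu)
    have "I n = pi * f m" if "n > m" for n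
    proof -
      have "I n = integral {0..pi} (\<lambda>y. \<Sum>k<n. u k y * cos (real m * y))"
        using integral_unique[OF I[of n]] by (simp add: sum_distrib_right)
      also have "\<dots> = (\<Sum>k<n. integral {0..pi} (\<lambda>y. u k y * cos (real m * y)))"
        by (intro integral_sum integrable_continuous_real continuous_intros cu) auto
      also have "\<dots> = (\<Sum>k<n. if k = m then pi * f m else 0)"
      proof (rule sum.cong[OF refl])
        fix k
        have "integral {0..pi} (\<lambda>y. u k y * cos (real m * y)) =
          integral {0..pi} (\<lambda>y. (f k * (if k = 0 then 1 else 2)) *
              (cos (real k * y) * cos (real m * y)))"
          by (simp add: u_def mult_ac)
        also have "\<dots> = (f k * (if k = 0 then 1 else 2)) * integral {0..pi}
            (\<lambda>y. cos (real k * y) * cos (real m * y))"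
          by (rule integral_mult_right)
        finally show "integral {0..pi} (\<lambda>y. u k y * cos (real m * y)) = (if k = m then pi * f m else 0)"
          by (simp add: integral_cos_cos)
      qed
      also have "\<dots> = pi * f m" using that by simp
      finally show ?thesis .
    qed
    then have "I \<longlonglongrightarrow> pi * f m"
      by (intro tendsto_eventually) (auto simp: eventually_at_top_dense)
    with lim have "J = pi * f m" using LIMSEQ_unique by blast
    with J show ?thesis by (simp add: integral_unique)
  qed
  define h where "h y = pi * G y - s y" for y
  have ch: "continuous_on {0..pi} h" unfolding h_def by (intro continuous_intros G cs)
  have "integral {0..pi} (\<lambda>y. h y * cos (real m * y)) = 0" for m
  proof -
    have "integral {0..pi} (\<lambda>y. h y * cos (real m * y)) =
      integral {0..pi} (\<lambda>y. pi * (cos (real m * y) * G y) - s y * cos (real m * y))"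
      by (simp add: h_def algebra_simps)
    also have "\<dots> = integral {0..pi} (\<lambda>y. pi * (cos (real m * y) * G y)) - integral {0..pi}
        (\<lambda>y. s y * cos (real m * y))"
      by (intro Henstock_Kurzweil_Integration.integral_diff integrable_continuous_real
          continuous_intros G cs)
    also have "\<dots> = 0" by (simp add: coeff f_def)
    finally show ?thesis .
  qed
  then have ortho: "integral {0..pi} (\<lambda>y. h y * cos (of_int m * y)) = 0" for m :: int
    by (cases m rule: int_cases2) auto
  have "integral {0..pi} (\<lambda>y. h y * cos y ^ k * cos (of_int m * y)) = 0" for k and m :: int
  proof (induction k arbitrary: m)
    case (Suc k)
    have cc: "cos y * cos (of_int m * y) = cos (of_int (m + 1) * y) / 2 +
        cos (of_int (m - 1) * y) / 2" for y :: real
      using cos_times_cos[of "of_int m * y" y] by (simp add: algebra_simps add_divide_distrib)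
    have "h y * cos y ^ Suc k * cos (of_int m * y) =
        h y * cos y ^ k * (cos y * cos (of_int m * y))" for y
      by (simp add: mult_ac)
    then have "h y * cos y ^ Suc k * cos (of_int m * y) =
        (h y * cos y ^ k * cos (of_int (m + 1) * y)) / 2 +
            (h y * cos y ^ k * cos (of_int (m - 1) * y)) / 2" for y
      unfolding cc by (simp add: distrib_left)
    then have "integral {0..pi} (\<lambda>y. h y * cos y ^ Suc k * cos (of_int m * y)) =
        integral {0..pi} (\<lambda>y. (h y * cos y ^ k * cos (of_int (m + 1) * y)) / 2) +
        integral {0..pi} (\<lambda>y. (h y * cos y ^ k * cos (of_int (m - 1) * y)) / 2)"
      by (simp only:) (intro Henstock_Kurzweil_Integration.integral_add integrable_continuous_real
          continuous_intros ch; simp)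
    then show ?case using Suc[of "m + 1"] Suc[of "m - 1"] by simp
  qed (use ortho in simp)
  from this[where m = 0] have "integral {0..pi} (\<lambda>y. h y * cos y ^ k) = 0" for k by simp
  then have "h x = 0"
    by (intro moments_determine[of 0 pi h cos])
        (use ch x in \<open>auto intro!: continuous_intros inj_onI cos_inj_pi\<close>)
  then have "s x = pi * G x" by (simp add: h_def)
  moreover have "summable (\<lambda>k. u k x)"
    by (rule summable_comparison_test'[OF sm, of 0]) (use bnd in auto)
  ultimately have "(\<lambda>k. u k x) sums (pi * G x)" unfolding s_def by (metis summable_sums)
  then show ?thesis by (simp only: u_def f_def)
qed

section \<open>Tail integrals and their cosine transforms\<close>

text \<open>
  The factor \<open>1/2\<close> makes tail integrals correspond exactly to \<open>-(1/w) d/dw\<close> on cosine transforms.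
\<close>

definition tail_integral :: "real \<Rightarrow> (real \<Rightarrow> real) \<Rightarrow> real \<Rightarrow> real" where
  "tail_integral R H s = integral {s..R\<^sup>2} H / 2"

definition cos_transform :: "real \<Rightarrow> (real \<Rightarrow> real) \<Rightarrow> real \<Rightarrow> real" where
  "cos_transform R H w = integral {0..R} (\<lambda>t. cos (w * t) * H (t\<^sup>2))"

lemma tail_integral_eq_0:
  assumes "s \<ge> R\<^sup>2"
  shows "tail_integral R H s = 0"
  using assms by (cases "s = R\<^sup>2") (auto simp: tail_integral_def)

lemma tail_integral_marginal:
  assumes "continuous_on {0..} H" "R > 0" "\<And>s. s \<ge> R\<^sup>2 \<Longrightarrow> H s = 0" "s \<ge> 0"
  shows "marginal R (marginal R H) s = (2 * pi) * tail_integral R H s"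
  using marginal_marginal[OF assms] by (simp add: tail_integral_def)

text \<open>
  Continuity is inherited from the double marginal, which avoids treating the end point \<open>R\<^sup>2\<close>
  separately.
\<close>

lemma continuous_on_tail_integral:
  assumes "continuous_on {0..} H" "R > 0" "\<And>s. s \<ge> R\<^sup>2 \<Longrightarrow> H s = 0"
  shows "continuous_on {0..} (tail_integral R H)"
proof -
  have "continuous_on {0..} (\<lambda>s. marginal R (marginal R H) s / (2 * pi))"
    by (intro continuous_intros continuous_on_marginal assms) auto
  also have "?this \<longleftrightarrow> ?thesis"
    by (intro continuous_on_cong) (use tail_integral_marginal[OF assms] in auto)
  finally show ?thesis .
qed

text \<open>
  Integrating out two coordinates produces the tail integral, up to a positive factor; this is
  where the parity of the dimension enters.
\<close>

lemma radial_psd_tail_integral: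
  assumes psd: "radial_psd (Suc (Suc k)) H" and H: "continuous_on {0..} H" "R > 0" "\<And>s. s \<ge> R\<^sup>2 \<Longrightarrow>
      H s = 0"
  shows "radial_psd k (tail_integral R H)"
proof -
  have "radial_psd k (marginal R (marginal R H))"
    by (intro radial_psd_marginal psd continuous_on_marginal H marginal_eq_0[of "R\<^sup>2"])
  then have *: "0 \<le> (\<Sum>x\<in>S. \<Sum>y\<in>S. c x * c y * marginal R (marginal R H) (sq_dist k x y))"
      if "finite S" for S c
    using that by (simp add: radial_psd_def psd_kernel_def)
  show ?thesis unfolding radial_psd_def psd_kernel_def
  proof (intro allI impI)
    fix S :: "(nat \<Rightarrow> real) set" and c :: "(nat \<Rightarrow> real) \<Rightarrow> real" assume "finite S"
    have eq: "marginal R (marginal R H) (sq_dist k x y) =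
        (2 * pi) * tail_integral R H (sq_dist k x y)" for x y
      by (rule tail_integral_marginal[OF H sq_dist_nonneg])
    from *[OF \<open>finite S\<close>, of c]
    have "0 \<le> (2 * pi) * (\<Sum>x\<in>S. \<Sum>y\<in>S. c x * c y * tail_integral R H (sq_dist k x y))"
      by (simp add: eq sum_distrib_left mult_ac)
    then show "0 \<le> (\<Sum>x\<in>S. \<Sum>y\<in>S. c x * c y * tail_integral R H (sq_dist k x y))"
      using pi_gt_zero by (auto simp: zero_le_mult_iff)
  qed
qed

lemma DERIV_tail_integral:
  assumes "continuous_on {0..} H" "s \<in> {0..R\<^sup>2}"
  shows "(tail_integral R H has_real_derivative - H s / 2) (at s within {0..R\<^sup>2})"
proof -
  have "continuous_on {0..R\<^sup>2} H" by (rule continuous_on_subset[OF assms(1)]) auto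
  from DERIV_cdivide[OF integral_has_real_derivative'[OF this assms(2)], of 2]
  show ?thesis by (simp add: tail_integral_def[abs_def])
qed

text \<open>
  The derivative of the tail is \<open>-H/2\<close>.
\<close>

lemma tail_integral_zero_imp:
  assumes H: "continuous_on {0..} H" and R: "R > 0"
    and zero: "\<And>t. t \<in> {0..R} \<Longrightarrow> tail_integral R H (t\<^sup>2) = 0" and t: "t \<in> {0..R}"
  shows "H (t\<^sup>2) = 0"
proof -
  have z: "tail_integral R H s = 0" if "s \<in> {0..R\<^sup>2}" for s
  proof -
    have "sqrt s \<in> {0..R}" using that R by (auto intro: real_le_lsqrt)
    then show ?thesis using zero[of "sqrt s"] that by simp
  qed
  have t2: "t\<^sup>2 \<in> {0..R\<^sup>2}" using t by (auto intro: power_mono)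
  have "(tail_integral R H has_real_derivative 0) (at (t\<^sup>2) within {0..R\<^sup>2})"
    by (rule has_field_derivative_transform_within[OF DERIV_const zero_less_one t2]) (simp add: z)
  then have "0 = - H (t\<^sup>2) / 2"
    using vector_derivative_unique_within_closed_interval[of 0 "R\<^sup>2" "t\<^sup>2" "tail_integral R H" 0
        "- H (t\<^sup>2) / 2"]
      DERIV_tail_integral[OF H t2] R t2
    by (simp add: has_real_derivative_iff_has_vector_derivative)
  then show ?thesis by simp
qed

lemma continuous_on_square:
  assumes "continuous_on {0..} H"
  shows "continuous_on A (\<lambda>t::real. H (t\<^sup>2) :: real)"
  using continuous_shift_square[OF assms, of 0 A] by simp

text \<open>
  Differentiation under the integral followed by integration by parts. The boundary terms vanish
  because \<open>sin 0 = 0\<close> and because the tail is \<open>0\<close> at \<open>R\<^sup>2\<close>.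
\<close>

lemma DERIV_cos_transform:
  assumes H: "continuous_on {0..} H" "R > 0" "\<And>s. s \<ge> R\<^sup>2 \<Longrightarrow> H s = 0"
  shows "(cos_transform R H has_real_derivative - (w * cos_transform R (tail_integral R H) w)) (at w)"
proof -
  let ?T = "tail_integral R H"
  have cT: "continuous_on A (\<lambda>t. ?T (t\<^sup>2))" for A
    by (intro continuous_on_square continuous_on_tail_integral H)
  have cH: "continuous_on A (\<lambda>t. H (t\<^sup>2))" for A by (intro continuous_on_square H)
  have "((\<lambda>t. w * (cos (w * t) * ?T (t\<^sup>2)) - sin (w * t) * (t * H (t\<^sup>2))) has_integral
     (sin (w * R) * ?T (R\<^sup>2) - sin (w * 0) * ?T (0\<^sup>2))) {0..R}"
  proof (rule fundamental_theorem_of_calculus)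
    fix t assume t: "t \<in> {0..R}"
    have "((\<lambda>t. t\<^sup>2) has_real_derivative 2 * t) (at t within {0..R})"
      by (auto intro!: derivative_eq_intros)
    moreover have "(?T has_real_derivative - H (t\<^sup>2) / 2) (at (t\<^sup>2) within (\<lambda>t. t\<^sup>2) ` {0..R})"
    proof (rule DERIV_subset)
      show "(?T has_real_derivative - H (t\<^sup>2) / 2) (at (t\<^sup>2) within {0..R\<^sup>2})"
        using t by (intro DERIV_tail_integral H) (auto intro: power_mono)
    qed (auto intro: power_mono)
    ultimately have "((\<lambda>t. ?T (t\<^sup>2)) has_real_derivative (- H (t\<^sup>2) / 2) * (2 * t)) (at t within {0..R})"
      using DERIV_image_chain[of ?T "- H (t\<^sup>2) / 2" "\<lambda>t. t\<^sup>2" t "{0..R}" "2 * t"] by (simp add: o_def)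
    then have "((\<lambda>t. sin (w * t) * ?T (t\<^sup>2)) has_real_derivative
        sin (w * t) * ((- H (t\<^sup>2) / 2) * (2 * t)) + (cos (w * t) * w) * ?T (t\<^sup>2)) (at t within {0..R})"
      by (auto intro!: derivative_eq_intros)
    then show "((\<lambda>t. sin (w * t) * ?T (t\<^sup>2)) has_vector_derivative
        w * (cos (w * t) * ?T (t\<^sup>2)) - sin (w * t) * (t * H (t\<^sup>2))) (at t within {0..R})"
      by (simp add: has_real_derivative_iff_has_vector_derivative algebra_simps)
  qed (use H in simp)
  then have "integral {0..R} (\<lambda>t. w * (cos (w * t) * ?T (t\<^sup>2)) - sin (w * t) * (t * H (t\<^sup>2))) = 0"
    by (simp add: integral_unique tail_integral_eq_0)
  moreover have "integral {0..R} (\<lambda>t. w * (cos (w * t) * ?T (t\<^sup>2)) - sin (w * t) * (t * H (t\<^sup>2))) =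
    integral {0..R} (\<lambda>t. w * (cos (w * t) * ?T (t\<^sup>2))) - integral {0..R}
        (\<lambda>t. sin (w * t) * (t * H (t\<^sup>2)))"
    by (intro Henstock_Kurzweil_Integration.integral_diff integrable_continuous_real
        continuous_intros cT cH)
  ultimately have "integral {0..R} (\<lambda>t. sin (w * t) * (t * H (t\<^sup>2))) = w * cos_transform R ?T w"
    by (simp add: cos_transform_def)
  then show ?thesis
    using DERIV_integral_cos[OF cH[of "{0..R}"], of w] by (simp add: cos_transform_def[abs_def])
qed

text \<open>
  With the coefficients \<open>cos (w q)\<close> and \<open>sin (w q)\<close> at the point \<open>q\<close>, the addition theorem turns the
  quadratic forms of \<open>H\<close> into lattice sums of \<open>cos (w v) * H (v\<^sup>2)\<close>.
\<close>

lemma cos_transform_nonneg: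
  assumes psd: "radial_psd 1 H" and H: "continuous_on {0..} H" "R > 0" "\<And>s. s \<ge> R\<^sup>2 \<Longrightarrow> H s = 0"
  shows "cos_transform R H w \<ge> 0"
proof -
  define \<psi> where "\<psi> v = cos (w * v) * H (v\<^sup>2)" for v
  have c: "continuous_on A \<psi>" for A
    unfolding \<psi>_def by (intro continuous_intros continuous_on_square H)
  have "0 \<le> integral {-R..R} \<psi>"
  proof (rule integral_nonneg_of_lattice[OF c H(2)])
    show "\<psi> v = 0" if "\<bar>v\<bar> \<ge> R" for v
    proof -
      have "v\<^sup>2 \<ge> R\<^sup>2" using that H(2) by (simp add: abs_le_square_iff[symmetric])
      then show ?thesis by (simp add: \<psi>_def H)
    qed
    fix n :: nat and e :: real
    have fam: "0 \<le> (\<Sum>q<n. \<Sum>p<n. c q * c p * H (((real q - real p) * e)\<^sup>2))" for c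
      using psd_kernel_family[OF psd[unfolded radial_psd_def], of "{..<n}" c "\<lambda>q _. real q * e"]
      by (simp add: sq_dist_def left_diff_distrib)
    have "(\<Sum>q<n. \<Sum>p<n. \<psi> ((real p - real q) * e)) =
       (\<Sum>q<n. \<Sum>p<n. cos (w * (real q * e)) * cos (w * (real p * e)) * H (((real q - real p) * e)\<^sup>2)) +
       (\<Sum>q<n. \<Sum>p<n. sin (w * (real q * e)) * sin (w * (real p * e)) * H (((real q - real p) * e)\<^sup>2))"
      unfolding sum.distrib[symmetric]
    proof (intro sum.cong refl)
      fix p q :: nat
      have "((real p - real q) * e)\<^sup>2 = ((real q - real p) * e)\<^sup>2"
        by (simp add: power_mult_distrib power2_commute)
      moreover have "cos (w * ((real p - real q) * e)) =
          cos (w * (real q * e)) * cos (w * (real p * e)) +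
              sin (w * (real q * e)) * sin (w * (real p * e))"
        using cos_diff[of "w * (real p * e)" "w * (real q * e)"] by (simp add: algebra_simps)
      ultimately show "\<psi> ((real p - real q) * e) =
        cos (w * (real q * e)) * cos (w * (real p * e)) * H (((real q - real p) * e)\<^sup>2) +
        sin (w * (real q * e)) * sin (w * (real p * e)) * H (((real q - real p) * e)\<^sup>2)"
        by (simp add: \<psi>_def algebra_simps)
    qed
    then show "0 \<le> (\<Sum>q<n. \<Sum>p<n. \<psi> ((real p - real q) * e))"
      using fam[of "\<lambda>q. cos (w * (real q * e))"] fam[of "\<lambda>q. sin (w * (real q * e))"] by simp
  qed
  also have "integral {-R..R} \<psi> = integral {-R..0} \<psi> + integral {0..R} \<psi>"
    using H(2) by (intro Henstock_Kurzweil_Integration.integral_combine[symmetric]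
        integrable_continuous_real c) auto
  also have "integral {-R..0} \<psi> = integral {0..R} \<psi>"
    using Henstock_Kurzweil_Integration.integral_reflect_real[of R 0 \<psi>] by (simp add: \<psi>_def[abs_def])
  finally show ?thesis by (simp add: cos_transform_def \<psi>_def[abs_def])
qed

lemma tail_iterates:
  fixes H :: "nat \<Rightarrow> real \<Rightarrow> real"
  assumes R: "R > 0" and H0: "continuous_on {0..} (H 0)" "\<And>s. s \<ge> R\<^sup>2 \<Longrightarrow> H 0 s = 0"
    and HS: "\<And>j. H (Suc j) = tail_integral R (H j)"
  shows "continuous_on {0..} (H j) \<and> (\<forall>s\<ge>R\<^sup>2. H j s = 0)"
proof (induction j)
  case (Suc j)
  then show ?case unfolding HS
    using continuous_on_tail_integral[of "H j" R] R tail_integral_eq_0[of R _ "H j"] by auto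
qed (use H0 in auto)

lemma radial_psd_tails:
  fixes H :: "nat \<Rightarrow> real \<Rightarrow> real"
  assumes R: "R > 0" and H0: "continuous_on {0..} (H 0)" "\<And>s. s \<ge> R\<^sup>2 \<Longrightarrow> H 0 s = 0"
    and HS: "\<And>j. H (Suc j) = tail_integral R (H j)"
    and psd: "radial_psd (2 * L + 1) (H 0)" and j: "j \<le> L"
  shows "radial_psd (2 * (L - j) + 1) (H j)"
  using j
proof (induction j)
  case (Suc j)
  have "radial_psd (Suc (Suc (2 * (L - Suc j) + 1))) (H j)"
  proof -
    have "L - j = Suc (L - Suc j)" using Suc.prems by simp
    then have "2 * (L - j) + 1 = Suc (Suc (2 * (L - Suc j) + 1))" by simp
    then show ?thesis using Suc by simp
  qed
  then show ?case unfolding HS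
    by (rule radial_psd_tail_integral) (use tail_iterates[of R H, OF R H0 HS] R in auto)
qed (use psd in simp)

section \<open>From cosine series to Gegenbauer series\<close>

text \<open>
  The value \<open>0\<close> is subtracted for \<open>n < 2\<close>, as if \<open>p\<close> were extended by \<open>0\<close> to negative arguments.
\<close>

definition skip_diff :: "(nat \<Rightarrow> real) \<Rightarrow> nat \<Rightarrow> real" where
  "skip_diff p n = p n - (if n < 2 then 0 else p (n - 2))"

text \<open>
  The value \<open>p n\<close> is a sum of at most \<open>n + 1\<close> differences.
\<close>

lemma skip_diff_bound:
  assumes "\<And>n. \<bar>skip_diff p n\<bar> \<le> c * (real n + 1) ^ m" and c: "c \<ge> 0"
  shows "\<bar>p n\<bar> \<le> c * (real n + 1) ^ Suc m"
proof (induction n rule: less_induct)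
  case (less n)
  show ?case
  proof (cases "n < 2")
    case True
    then have "\<bar>p n\<bar> \<le> c * (real n + 1) ^ m * 1" using assms(1)[of n] by (simp add: skip_diff_def)
    also have "\<dots> \<le> c * (real n + 1) ^ m * (real n + 1)" using c by (intro mult_left_mono) auto
    finally show ?thesis by (simp add: mult_ac)
  next
    case False
    then have "p n = skip_diff p n + p (n - 2)" by (simp add: skip_diff_def)
    then have "\<bar>p n\<bar> \<le> \<bar>skip_diff p n\<bar> + \<bar>p (n - 2)\<bar>" by simp
    also have "\<dots> \<le> c * (real n + 1) ^ m + c * (real (n - 2) + 1) ^ Suc m"
      using assms(1)[of n] less[of "n - 2"] False by simp
    also have "\<dots> \<le> c * (real n + 1) ^ m + c * ((real n + 1) ^ m * real n)"
    proof (intro add_left_mono mult_left_mono c)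
      have "(real (n - 2) + 1) ^ m * (real (n - 2) + 1) \<le> (real n + 1) ^ m * real n"
        by (intro mult_mono power_mono) (use False in auto)
      then show "(real (n - 2) + 1) ^ Suc m \<le> (real n + 1) ^ m * real n" by (simp add: mult_ac)
    qed
    also have "\<dots> = c * (real n + 1) ^ Suc m" by (simp add: algebra_simps)
    finally show ?thesis .
  qed
qed

lemma skip_diff_by_parts:
  "(\<Sum>n<K + 2. a n * skip_diff p n) =
     (\<Sum>n<K. p n * (a n - a (n + 2))) + p K * a K + p (Suc K) * a (Suc K)"
proof (induction K)
  case 0
  show ?case by (simp add: skip_diff_def numeral_2_eq_2)
next
  case (Suc K)
  have "(\<Sum>n<Suc K + 2. a n * skip_diff p n) = (\<Sum>n<K + 2. a n * skip_diff p n) +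
      a (K + 2) * (p (K + 2) - p K)"
    by (simp add: skip_diff_def)
  also have "\<dots> = (\<Sum>n<Suc K. p n * (a n - a (n + 2))) + p (Suc K) * a (Suc K) +
      p (Suc (Suc K)) * a (Suc (Suc K))"
    unfolding Suc by (simp add: algebra_simps)
  finally show ?case .
qed

text \<open>
  The factor clears the parameter from the contiguity relation \<open>gegenbauer_param_Suc\<close>.
\<close>

definition scaled_gegenbauer :: "nat \<Rightarrow> real \<Rightarrow> nat \<Rightarrow> real" where
  "scaled_gegenbauer j t n = fact (j - 1) * poly (gegenbauer (real j) n) t"

lemma skip_diff_scaled_gegenbauer:
  assumes "j \<ge> 1"
  shows "skip_diff (scaled_gegenbauer (Suc j) t) n = (real n + real j) * scaled_gegenbauer j t n"
proof -
  have "fact j = real j * fact (j - 1)" using assms by (cases j) auto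
  then have "skip_diff (scaled_gegenbauer (Suc j) t) n =
      fact (j - 1) * (real j * (poly (gegenbauer (real j + 1) n) t -
       (if n < 2 then 0 else poly (gegenbauer (real j + 1) (n - 2)) t)))"
    by (simp add: skip_diff_def scaled_gegenbauer_def algebra_simps)
  also have "\<dots> = fact (j - 1) * ((real n + real j) * poly (gegenbauer (real j) n) t)"
    using assms by (subst gegenbauer_param_Suc) auto
  finally show ?thesis by (simp add: scaled_gegenbauer_def)
qed

lemma skip_diff_scaled_gegenbauer_1: "skip_diff (scaled_gegenbauer 1 (cos x)) n =
    (if n = 0 then 1 else 2 * cos (real n * x))"
  unfolding skip_diff_def scaled_gegenbauer_def diff_self_eq_0 fact_0 mult_1_left of_nat_1
      by (rule gegenbauer_1_cos)

lemma scaled_gegenbauer_bound: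
  "\<exists>c\<ge>0. \<forall>n. \<bar>scaled_gegenbauer (Suc j) (cos x) n\<bar> \<le> c * (real n + 1) ^ (2 * j + 1)"
proof (induction j)
  case 0
  have "\<bar>skip_diff (scaled_gegenbauer 1 (cos x)) n\<bar> \<le> 2 * (real n + 1) ^ 0" for n
    unfolding skip_diff_scaled_gegenbauer_1 by (simp add: abs_mult)
  from skip_diff_bound[of "scaled_gegenbauer 1 (cos x)" 2 0, OF this] show ?case
      by (intro exI[of _ 2]) auto
next
  case (Suc j)
  then obtain c where c: "c \<ge> 0" "\<And>n. \<bar>scaled_gegenbauer (Suc j) (cos x) n\<bar> \<le>
      c * (real n + 1) ^ (2 * j + 1)" by blast
  have "\<bar>skip_diff (scaled_gegenbauer (Suc (Suc j)) (cos x)) n\<bar> \<le>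
      ((real j + 1) * c) * (real n + 1) ^ (2 * j + 2)" for n
  proof -
    have "\<bar>skip_diff (scaled_gegenbauer (Suc (Suc j)) (cos x)) n\<bar> =
        (real n + real (Suc j)) * \<bar>scaled_gegenbauer (Suc j) (cos x) n\<bar>"
      by (simp add: skip_diff_scaled_gegenbauer abs_mult)
    also have "\<dots> \<le> ((real j + 1) * (real n + 1)) * (c * (real n + 1) ^ (2 * j + 1))"
      by (intro mult_mono c) (auto simp: algebra_simps)
    finally show ?thesis by (simp add: mult_ac)
  qed
  from skip_diff_bound[OF this] c(1) show ?case by (intro exI[of _ "(real j + 1) * c"]) auto
qed

text \<open>
  Each summation by parts raises the Gegenbauer parameter by one and replaces the coefficients by
  their next iterated difference. The boundary terms tend to \<open>0\<close>: by \<open>chain_decay\<close> the coefficients at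
  stage \<open>j\<close> are of smaller order than \<open>K\<^sup>-\<^sup>2\<^sup>j\<^sup>-\<^sup>1\<close>, while the polynomials grow at most like \<open>K\<^sup>2\<^sup>j\<^sup>+\<^sup>1\<close>.
\<close>

lemma gegenbauer_series:
  fixes F :: "nat \<Rightarrow> real \<Rightarrow> real"
  assumes deriv: "\<And>j w. (F j has_real_derivative - (w * F (Suc j) w)) (at w)"
    and nonneg: "\<And>j w. j \<le> L \<Longrightarrow> F j w \<ge> 0" and sm: "summable (\<lambda>k. F 0 (real k))"
    and lim: "(\<lambda>k. F 0 (real k) * (if k = 0 then 1 else 2 * cos (real k * x))) sums S"
    and j: "j \<le> L"
  shows "(\<lambda>K. \<Sum>n<K. diffq (F 0) j (real n +
      real j) * skip_diff (scaled_gegenbauer (Suc j) (cos x)) n) \<longlonglongrightarrow> S"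
  using j
proof (induction j)
  case 0
  show ?case using lim by (simp add: sums_def skip_diff_scaled_gegenbauer_1[unfolded One_nat_def])
next
  case (Suc j)
  define a where "a n = diffq (F 0) j (real n + real j)" for n
  define p where "p = scaled_gegenbauer (Suc j) (cos x)"
  have IH: "(\<lambda>K. \<Sum>n<K + 2. a n * skip_diff p n) \<longlonglongrightarrow> S"
    using LIMSEQ_ignore_initial_segment[OF Suc.IH, of 2] Suc.prems by (simp add: a_def p_def)
  obtain c where c: "c \<ge> 0" "\<And>n. \<bar>p n\<bar> \<le> c * (real n + 1) ^ (2 * j + 1)"
    using scaled_gegenbauer_bound[of j x] unfolding p_def by blast
  have a_le: "\<bar>a n\<bar> \<le> 2 ^ j * F j (real n)" for n
  proof (cases j)
    case 0
    then show ?thesis using nonneg[of 0 "real n"] by (simp add: a_def)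
  next
    case (Suc i)
    then show ?thesis
      using diffq_le[where F = F, OF deriv, of i "real n + real j"] nonneg Suc.prems \<open>Suc j \<le> L\<close>
          by (simp add: a_def)
  qed
  have bdry: "(\<lambda>K. p K * a K) \<longlonglongrightarrow> 0"
  proof (rule Lim_null_comparison)
    show "\<forall>\<^sub>F K in sequentially. norm (p K * a K) \<le>
        c * 2 ^ (2 * j + 1) * 2 ^ j * (real K ^ (2 * j + 1) * F j (real K))"
      using eventually_ge_at_top[of 1]
    proof eventually_elim
      case (elim K)
      have "norm (p K * a K) \<le> (c * (real K + 1) ^ (2 * j + 1)) * (2 ^ j * F j (real K))"
        unfolding real_norm_def abs_mult by (intro mult_mono c a_le) (use c in auto)
      also have "\<dots> \<le> (c * (2 * real K) ^ (2 * j + 1)) * (2 ^ j * F j (real K))"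
        using elim c nonneg[of j] Suc.prems by (intro mult_right_mono mult_left_mono power_mono) auto
      finally show ?case by (simp add: power_mult_distrib mult_ac)
    qed
    have "(\<lambda>K. real K ^ (2 * j + 1) * F j (real K)) \<longlonglongrightarrow> 0"
      using filterlim_compose[OF chain_decay[where F = F, OF deriv nonneg sm]
          filterlim_real_sequentially] Suc.prems by simp
    from tendsto_mult_left[OF this, of "c * 2 ^ (2 * j + 1) * 2 ^ j"]
    show "(\<lambda>K. c * 2 ^ (2 * j + 1) * 2 ^ j * (real K ^ (2 * j + 1) * F j (real K))) \<longlonglongrightarrow> 0" by simp
  qed
  have "(\<lambda>K. (\<Sum>n<K + 2. a n * skip_diff p n) - p K * a K - p (Suc K) * a (Suc K)) \<longlonglongrightarrow> S - 0 - 0"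
    by (intro tendsto_diff IH bdry LIMSEQ_Suc[OF bdry])
  also have "(\<lambda>K. (\<Sum>n<K + 2. a n * skip_diff p n) - p K * a K - p (Suc K) * a (Suc K)) =
     (\<lambda>K. \<Sum>n<K. p n * (a n - a (n + 2)))"
    unfolding skip_diff_by_parts by simp
  also have "(\<lambda>K. \<Sum>n<K. p n * (a n - a (n + 2))) =
     (\<lambda>K. \<Sum>n<K. diffq (F 0) (Suc j) (real n + real (Suc j)) * skip_diff
         (scaled_gegenbauer (Suc (Suc j)) (cos x)) n)"
  proof (intro ext sum.cong refl)
    fix n
    have "diffq (F 0) (Suc j) (real n + real (Suc j)) * (real n + real (Suc j)) = a n - a (n + 2)"
    proof -
      have e: "real n + real (Suc j) - 1 = real n + real j" "real n + real (Suc j) + 1 =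
          real (n + 2) + real j"
        "real n + real (Suc j) \<noteq> 0" by (simp_all add: add_nonneg_eq_0_iff)
      show ?thesis unfolding diffq.simps a_def e(1,2) using e(3) by simp
    qed
    then show "p n * (a n - a (n + 2)) =
        diffq (F 0) (Suc j) (real n + real (Suc j)) * skip_diff
            (scaled_gegenbauer (Suc (Suc j)) (cos x)) n"
      by (subst skip_diff_scaled_gegenbauer) (simp_all add: p_def)
  qed
  finally show ?case by simp
qed

section \<open>From Euclidean spaces to spheres\<close>

theorem theorem1p2:
  fixes d :: nat and g :: "real \<Rightarrow> real"
  assumes "d \<ge> 3" and "odd d"
    and "CARD('n::finite) = d" and "CARD('m::finite) = d + 1"
    and "continuous_on {0..} g"
    and "compact (closure {t \<in> {0..}. g t \<noteq> 0})"
    and "closure {t \<in> {0..}. g t \<noteq> 0} \<subseteq> {0..pi}"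
    and "isotropic_pos_def_on (UNIV :: (real ^ 'n) set) dist g"
  shows "isotropic_pos_def_on (sphere 0 1 :: (real ^ 'm) set) geodesic_dist g"
proof -
  obtain L where d: "d = 2 * L + 1" using \<open>odd d\<close> by (elim oddE)
  have L: "L \<ge> 1" using \<open>d \<ge> 3\<close> d by simp
  have g_out: "g t = 0" if "t \<ge> pi" for t
  proof -
    have out: "g t = 0" if "t > pi" for t
    proof (rule ccontr)
      assume "g t \<noteq> 0"
      then have "t \<in> closure {t \<in> {0..}. g t \<noteq> 0}"
        using order.trans[OF pi_ge_zero less_imp_le[OF that]]
        by (intro subsetD[OF closure_subset]) auto
      then show False using assms(7) that by auto
    qed
    \<comment> \<open>The support may reach \<open>\<pi>\<close>, where \<open>g\<close> vanishes by continuity from the right.\<close>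
    have "g pi = 0"
    proof -
      have "(g \<longlongrightarrow> g pi) (at pi within {pi..})"
        using continuous_on_subset[OF assms(5), of "{pi..}"] pi_gt_zero
        by (auto simp: continuous_on_def)
      moreover have "(g \<longlongrightarrow> 0) (at pi within {pi..})"
        by (rule tendsto_eventually) (auto simp: eventually_at_filter out)
      moreover have "at pi within {pi..} \<noteq> bot" by (simp add: at_within_Ici_at_right)
      ultimately show ?thesis using tendsto_unique by blast
    qed
    with out that show ?thesis by (cases "t = pi") auto
  qed
  define H where "H j = (tail_integral pi ^^ j) (\<lambda>s. g (sqrt s))" for j
  have H0: "continuous_on {0..} (H 0)" "\<And>s. s \<ge> pi\<^sup>2 \<Longrightarrow> H 0 s = 0"
  proof -
    show "continuous_on {0..} (H 0)" unfolding H_def funpow_0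
      by (rule continuous_on_compose2[OF assms(5)]) (auto intro!: continuous_intros)
    show "H 0 s = 0" if "s \<ge> pi\<^sup>2" for s
      unfolding H_def funpow_0 using that by (intro g_out real_le_rsqrt)
  qed
  have HS: "H (Suc j) = tail_integral pi (H j)" for j by (simp add: H_def)
  note H = tail_iterates[of pi H, OF pi_gt_zero H0 HS]
  have psd: "radial_psd (2 * (L - j) + 1) (H j)" if "j \<le> L" for j
    using radial_psd_tails[of pi H L j, OF pi_gt_zero H0 HS _ that]
      radial_psd_if_isotropic[OF assms(8)] assms(3) d by (simp add: H_def)
  define F where "F j = cos_transform pi (H j)" for j
  have deriv: "(F j has_real_derivative - (w * F (Suc j) w)) (at w)" for j w
    unfolding F_def HS using H[of j] by (intro DERIV_cos_transform) auto
  have nonneg: "F j w \<ge> 0" if "j \<le> L" for j w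
    unfolding F_def using psd[OF that] H[of j] radial_psd_antimono[of 1 "2 * (L - j)" "H j"]
    by (intro cos_transform_nonneg) auto
  have cH: "continuous_on {0..pi} (\<lambda>t. H j (t\<^sup>2))" for j
    using H[of j] by (intro continuous_on_square) auto
  have H0g: "H 0 (t\<^sup>2) = g t" if "t \<ge> 0" for t using that by (simp add: H_def)
  have sm: "summable (\<lambda>k. F 0 (real k))"
    unfolding F_def cos_transform_def
    by (rule cos_coeffs_summable[OF cH]) (use nonneg[of 0] in \<open>simp add: F_def cos_transform_def\<close>)
  have series: "(\<lambda>k. F 0 (real k) * (if k = 0 then 1 else 2 * cos (real k * x))) sums (pi * g x)"
    if "x \<in> {0..pi}" for x
  proof -
    have "summable (\<lambda>k. \<bar>F 0 (real k)\<bar>)" using sm nonneg[of 0] by simp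
    then show ?thesis
      using cos_series_inversion[OF cH[of 0] _ that] that H0g[of x]
          by (simp add: F_def cos_transform_def)
  qed
  have g0: "g 0 > 0"
  proof -
    have "pos_def_matrix 1 (\<lambda>i j. g (dist (0 :: real ^ 'n) 0))"
      using assms(8) unfolding isotropic_pos_def_on_def
      by (auto dest!: spec[of _ "1::nat"] spec[of _ "\<lambda>_. 0 :: real ^ 'n"] simp: inj_on_def)
    then show ?thesis unfolding pos_def_matrix_def by (auto dest!: spec[of _ "\<lambda>_. 1 :: real"])
  qed
  \<comment> \<open>The cosine transform and taking tails are injective, so a locally vanishing \<open>F L\<close>
      would force \<open>g 0 = 0\<close>.\<close>
  have nz: "\<exists>w\<in>{a<..<b}. F L w \<noteq> 0" if "a < b" for a b
  proof (rule ccontr)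
    assume "\<not> ?thesis"
    then have z: "H L (t\<^sup>2) = 0" if "t \<in> {0..pi}" for t
      using cos_transform_locally_zero[OF pi_gt_zero cH[of L] \<open>a < b\<close> _ that]
      by (auto simp: F_def cos_transform_def)
    have "\<forall>t\<in>{0..pi}. H (L - i) (t\<^sup>2) = 0" if "i \<le> L" for i
      using that
    proof (induction i)
      case (Suc i)
      have "L - i = Suc (L - Suc i)" using Suc.prems by simp
      then have zero: "tail_integral pi (H (L - Suc i)) (t\<^sup>2) = 0" if "t \<in> {0..pi}" for t
        using Suc.IH Suc.prems that unfolding HS[of "L - Suc i", symmetric] by simp
      have "continuous_on {0..} (H (L - Suc i))" using H by blast
      then show ?case by (blast intro: tail_integral_zero_imp[OF _ pi_gt_zero zero])
    qed (use z in simp)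
    from this[of L] have "H 0 (0\<^sup>2) = 0" using pi_ge_zero by (auto dest!: bspec[of _ _ 0])
    then show False using H0g[of 0] g0 by simp
  qed
  have U: "diffq (F 0) L (real n + real L) > 0" for n
  proof -
    obtain l where l: "L = Suc l" using L by (cases L) auto
    show ?thesis unfolding l
      by (rule diffq_pos[where F = F, OF deriv]) (use nonneg nz in \<open>auto simp: l\<close>)
  qed
  have DIM: "real DIM(real ^ 'm) = 2 * real L + 2" using assms(4) d by simp
  show ?thesis unfolding isotropic_pos_def_on_def pos_def_matrix_def
  proof (intro allI impI)
    fix N and x :: "nat \<Rightarrow> real ^ 'm" and c :: "nat \<Rightarrow> real"
    assume xs: "inj_on x {..<N} \<and> x ` {..<N} \<subseteq> sphere 0 1" and "\<exists>i<N. c i \<noteq> 0"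
    then obtain i0 where i0: "i0 < N" "c i0 \<noteq> 0" by blast
    have x: "norm (x i) = 1" if "i < N" for i
      using xs that by auto
    define t where "t i j = x i \<bullet> x j" for i j
    have t1: "\<bar>t i j\<bar> \<le> 1" if "i < N" "j < N" for i j
      using Cauchy_Schwarz_ineq2[of "x i" "x j"] x that by (simp add: t_def)
    define Q where "Q n = (\<Sum>i<N. \<Sum>j<N. c i * c j * poly (gegenbauer (real L) n) (t i j))" for n
    have Q: "Q n \<ge> 0" for n
      unfolding Q_def t_def using L by (intro gegenbauer_form_nonneg DIM x) auto
    have "\<exists>k. (\<Sum>i<N. \<Sum>j<N. c i * c j * t i j ^ k) \<noteq> 0"
    proof (rule power_forms_not_all_zero[where c = c, OF _ _ i0])
      show "t i i = 1" if "i < N" for i using x[OF that] by (simp add: t_def norm_eq_1)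
      show "- 1 \<le> t i j \<and> t i j < 1" if "i < N" "j < N" "i \<noteq> j" for i j
      proof -
        have "x i \<noteq> x j" using xs that by (auto dest: inj_onD)
        then have "t i j \<noteq> 1"
          using norm_cauchy_schwarz_eq[of "x i" "x j"] x that by (simp add: t_def)
        then show ?thesis using t1[OF that(1,2)] by auto
      qed
    qed
    then obtain m where "Q m \<noteq> 0"
      using gegenbauer_forms_determine_powers[where a = "real L" and N = N and c = c and t = t] L
          unfolding Q_def by force
    then have m: "Q m > 0" using Q[of m] by simp
    \<comment> \<open>\<open>e n\<close> is the contribution of degree \<open>n\<close> to \<open>\<pi>\<close> times the quadratic form of \<open>g\<close>.\<close>
    define e where "e n = diffq (F 0) L (real n + real L) *
        ((real n + real L) * (fact (L - 1) * Q n))" for n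
    have e: "e n \<ge> 0" for n
      unfolding e_def using U[of n] Q[of n] by (intro mult_nonneg_nonneg) auto
    have em: "e m > 0" unfolding e_def using U[of m] m L by (intro mult_pos_pos) auto
    have lim: "(\<lambda>K. \<Sum>n<K. diffq (F 0) L (real n + real L) *
        ((real n + real L) * scaled_gegenbauer L (t i j) n))
        \<longlonglongrightarrow> pi * g (geodesic_dist (x i) (x j))" if "i < N" "j < N" for i j
    proof -
      have cos: "cos (arccos (t i j)) = t i j" and range: "arccos (t i j) \<in> {0..pi}"
        using t1[OF that] by (auto simp: cos_arccos_abs arccos_lbound arccos_ubound abs_le_iff)
      have "(\<lambda>K. \<Sum>n<K. diffq (F 0) L (real n + real L) *
          skip_diff (scaled_gegenbauer (Suc L) (cos (arccos (t i j)))) n)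
          \<longlonglongrightarrow> pi * g (arccos (t i j))"
        by (rule gegenbauer_series[where F = F
            and L = L, OF deriv nonneg sm series[OF range] order.refl])
      then show ?thesis
        unfolding cos skip_diff_scaled_gegenbauer[OF L] by (simp only: geodesic_dist_def t_def)
    qed
    have "(\<lambda>K. \<Sum>i<N. \<Sum>j<N. c i * c j * (\<Sum>n<K. diffq (F 0) L (real n + real L) * ((real n + real L) * scaled_gegenbauer L (t i j) n)))
        \<longlonglongrightarrow> (\<Sum>i<N. \<Sum>j<N. c i * c j * (pi * g (geodesic_dist (x i) (x j))))"
      by (intro tendsto_sum tendsto_mult_left lim) auto
    moreover have "(\<Sum>i<N. \<Sum>j<N. c i * c j *
        (\<Sum>n<K. diffq (F 0) L (real n + real L) * ((real n + real L) * scaled_gegenbauer L (t i j) n))) =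
        (\<Sum>n<K. e n)" for K
    proof -
      have "(\<Sum>n<K. e n) = (\<Sum>n<K. \<Sum>i<N. \<Sum>j<N. c i * c j *
          (diffq (F 0) L (real n + real L) * ((real n + real L) * scaled_gegenbauer L (t i j) n)))"
        unfolding e_def Q_def scaled_gegenbauer_def by (simp add: sum_distrib_left mult_ac)
      also have "\<dots> = (\<Sum>i<N. \<Sum>n<K. \<Sum>j<N. c i * c j *
          (diffq (F 0) L (real n + real L) * ((real n + real L) * scaled_gegenbauer L (t i j) n)))"
        by (rule sum.swap)
      also have "\<dots> = (\<Sum>i<N. \<Sum>j<N. \<Sum>n<K. c i * c j *
          (diffq (F 0) L (real n + real L) * ((real n + real L) * scaled_gegenbauer L (t i j) n)))"
        by (intro sum.cong refl sum.swap)
      finally show ?thesis by (simp add: sum_distrib_left)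
    qed
    ultimately have "(\<lambda>K. \<Sum>n<K. e n) \<longlonglongrightarrow> (\<Sum>i<N. \<Sum>j<N. c i * c j * (pi * g (geodesic_dist (x i) (x j))))"
      by (simp only:)
    then have "e m \<le> (\<Sum>i<N. \<Sum>j<N. c i * c j * (pi * g (geodesic_dist (x i) (x j))))"
    proof (rule LIMSEQ_le_const, intro exI[of _ "Suc m"] allI impI)
      fix K assume "Suc m \<le> K"
      then show "e m \<le> (\<Sum>n<K. e n)" using e by (intro member_le_sum) auto
    qed
    also have "\<dots> = pi * (\<Sum>i<N. \<Sum>j<N. c i * g (geodesic_dist (x i) (x j)) * c j)"
      by (simp add: sum_distrib_left mult_ac)
    finally have "0 < pi * (\<Sum>i<N. \<Sum>j<N. c i * g (geodesic_dist (x i) (x j)) * c j)"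
      using em by linarith
    then show "0 < (\<Sum>i<N. \<Sum>j<N. c i * g (geodesic_dist (x i) (x j)) * c j)"
      by (simp add: zero_less_mult_iff)
  qed
qed

end
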